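(* Let $\zeta\in(0,1)$ and let $(v_l)_{l\geq 1}$ have the Poisson-Dirichlet distribution $PD(\zeta)$. Let $n\ge 1$, let $I_1,\ldots,I_r$ ($r\geq 1$) be a partition of $\{1,\ldots,n\}$ into nonempty sets, let $n_p=|I_p|$ for $p\leq r$, let $t_1,\ldots,t_n\in\mathbb{R}$ and let $s_p=\sum_{j\in I_p}t_j$ for $p\le r$. Then $$ \mathbb{E}\sum_{l_1,\ldots,l_r} v_{l_1}^{n_1}\cdots v_{l_r}^{n_r} = \mathbb{E}\sum_{l_1,\ldots,l_r} \frac{\exp\bigl(\sum_{p\leq r}(n_p-\zeta)s_p\bigr)} {\bigl(\sum_{p\leq r}v_{l_p}e^{s_p}+1-\sum_{p\leq r}v_{l_p}\bigr)^n}\; v_{l_1}^{n_1}\cdots v_{l_r}^{n_r}, $$ where both sums are over all $r$-tuples $(l_1,\ldots,l_r)$ of pairwise different indices in $\mathbb{N}=\{1,2,\ldots\}$.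
   Context: Given $\zeta\in(0,1)$, let $(u_l)_{l\geq 1}$ be the decreasing enumeration of a Poisson point process on $(0,\infty)$ with intensity measure $x^{-1-\zeta}dx$, and let $v_l=u_l/\sum_j u_j$. The distribution of the sequence $(v_l)_{l\ge1}$ is called the Poisson-Dirichlet distribution $PD(\zeta)$. *)

theory Defs
  imports "HOL-Probability.Probability"
begin

definition point_count :: "('w \<Rightarrow> 'a set) \<Rightarrow> 'a set \<Rightarrow> 'w \<Rightarrow> enat" where
  "point_count \<Xi> A \<omega> = (if finite (\<Xi> \<omega> \<inter> A) then enat (card (\<Xi> \<omega> \<inter> A)) else \<infinity>)"

text \<open>
  A Poisson point process is taken to be a random countable set of points (Kingman's definition),
  which is appropriate for intensity measures \<open>\<mu>\<close> without atoms. The probability of \<open>k\<close> points is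
  written out because \<open>poisson_pmf\<close> requires a positive rate, whereas \<open>\<mu> A = 0\<close> is allowed here.
\<close>

definition poisson_point_process :: "'w measure \<Rightarrow> 'a measure \<Rightarrow> ('w \<Rightarrow> 'a set) \<Rightarrow> bool" where
  "poisson_point_process M \<mu> \<Xi> \<longleftrightarrow>
     prob_space M \<and>
     (\<forall>\<omega>\<in>space M. countable (\<Xi> \<omega>) \<and> \<Xi> \<omega> \<subseteq> space \<mu>) \<and>
     (\<forall>A\<in>sets \<mu>. point_count \<Xi> A \<in> M \<rightarrow>\<^sub>M count_space UNIV) \<and>
     (\<forall>A\<in>sets \<mu>. emeasure \<mu> A < \<infinity> \<longrightarrow>
        (\<forall>k::nat. measure M {\<omega>\<in>space M. point_count \<Xi> A \<omega> = enat k}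
                  = exp (- measure \<mu> A) * measure \<mu> A ^ k / fact k)) \<and>
     (\<forall>A\<in>sets \<mu>. emeasure \<mu> A = \<infinity> \<longrightarrow> (AE \<omega> in M. point_count \<Xi> A \<omega> = \<infinity>)) \<and>
     (\<forall>(A :: nat \<Rightarrow> 'a set) J. finite J \<longrightarrow> A ` J \<subseteq> sets \<mu> \<longrightarrow> disjoint_family_on A J \<longrightarrow>
        prob_space.indep_vars M (\<lambda>_. count_space UNIV) (\<lambda>j. point_count \<Xi> (A j)) J)"

definition PD_intensity :: "real \<Rightarrow> real measure" where
  "PD_intensity \<zeta> =
     density (restrict_space lborel {0<..}) (\<lambda>x. ennreal (x powr (- 1 - \<zeta>)))"

text \<open>Sequences are indexed from \<open>0\<close>: \<open>u 0\<close> is the largest point of the process.\<close>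

definition decreasing_enumeration ::
    "'w measure \<Rightarrow> ('w \<Rightarrow> real set) \<Rightarrow> (nat \<Rightarrow> 'w \<Rightarrow> real) \<Rightarrow> bool" where
  "decreasing_enumeration M \<Xi> u \<longleftrightarrow>
     (\<forall>l. u l \<in> borel_measurable M) \<and>
     (AE \<omega> in M. (\<forall>k l. k < l \<longrightarrow> u l \<omega> < u k \<omega>) \<and> range (\<lambda>l. u l \<omega>) = \<Xi> \<omega>)"

text \<open>
  \<open>poisson_dirichlet \<zeta> D\<close>: the law \<open>D\<close> on the space of real sequences is \<open>PD(\<zeta>)\<close>. Taking the
  underlying probability space of the process to be one on \<open>nat \<Rightarrow> real\<close> is no restriction, since any
  \<open>u\<close> can be replaced by the coordinate process under its own law.
\<close>

definition poisson_dirichlet :: "real \<Rightarrow> (nat \<Rightarrow> real) measure \<Rightarrow> bool" where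
  "poisson_dirichlet \<zeta> D \<longleftrightarrow>
     (\<exists>(M :: (nat \<Rightarrow> real) measure) \<Xi> u.
        poisson_point_process M (PD_intensity \<zeta>) \<Xi> \<and>
        decreasing_enumeration M \<Xi> u \<and>
        D = distr M (\<Pi>\<^sub>M l\<in>UNIV. borel) (\<lambda>\<omega> l. u l \<omega> / (\<Sum>j. u j \<omega>)))"

definition has_poisson_dirichlet_distribution ::
    "'w measure \<Rightarrow> (nat \<Rightarrow> 'w \<Rightarrow> real) \<Rightarrow> real \<Rightarrow> bool" where
  "has_poisson_dirichlet_distribution M v \<zeta> \<longleftrightarrow>
     prob_space M \<and> (\<forall>l. v l \<in> borel_measurable M) \<and>
     poisson_dirichlet \<zeta> (distr M (\<Pi>\<^sub>M l\<in>UNIV. borel) (\<lambda>\<omega> l. v l \<omega>))"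

definition distinct_tuples :: "nat \<Rightarrow> (nat \<Rightarrow> nat) set" where
  "distinct_tuples r = {l \<in> {1..r} \<rightarrow>\<^sub>E UNIV. inj_on l {1..r}}"

end

theory Submission
  imports Defs
begin

text \<open>
  Let \<open>U\<close> be the sum of all points \<open>u l\<close>. Up to the factor \<open>exp (\<Sum>p. (m p - \<zeta>) * s p)\<close>, the summand on
  the right-hand side is the product of the \<open>u (l p) ^ m p\<close> divided by \<open>D ^ n\<close>, where \<open>D\<close> is the sum of
  all points in which the chosen points \<open>u (l p)\<close> are multiplied by \<open>exp (s p)\<close>; the powers of \<open>U\<close> cancel
  because the \<open>m p\<close> add up to \<open>n\<close>. Writing \<open>1 / D ^ n\<close> as a Gamma integral over \<open>lam\<close> of
  \<open>exp (- lam * D)\<close> makes the dependence on the points multiplicative, and for each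
  \<open>lam\<close> the Mecke identity for the Poisson process turns the expected sum over distinct indices into

  \<open>(\<Prod>p. exp ((m p - \<zeta>) * s p) * (\<integral> x ^ m p * exp (- lam * exp (s p) * x) \<partial>\<mu>)) * E exp (- lam * U)\<close>

  with the intensity \<open>\<mu>\<close> of density \<open>x powr (- 1 - \<zeta>)\<close>. The substitution \<open>y = exp (s p) * x\<close> in each factor
  (lemma \<open>PD_laplace_moment_scale\<close>) shows that this does not depend on \<open>s\<close>. For \<open>s = 0\<close> it gives the left-hand side
  (lemmas \<open>tilted_moment\<close> and \<open>tilted_moment_normalized\<close>).

  The instance of the Mecke identity that is needed (lemma \<open>mecke_exp\<close>) is obtained from the definition of the
  process by discretisation. The counts of points in the dyadic cells are independent Poisson
  variables, and \<open>E (N * h N) = \<mu> A * E (h (N + 1))\<close> for the count \<open>N\<close> of a set \<open>A\<close> gives an exact identity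
  for sums over tuples of distinct cells (lemma \<open>tuple_sum_mecke\<close>). Both sides converge as the mesh is refined,
  first for points in a band bounded away from \<open>0\<close> and infinity (lemma \<open>mecke_band\<close>) and then in general by
  monotone convergence. Almost surely the points are summable (lemma \<open>AE_summable_points\<close>).
\<close>

section \<open>Sums over tuples of distinct indices\<close>

lemma infsum_ennreal_eq_nn_integral_count_space:
  fixes f :: "'a \<Rightarrow> ennreal"
  assumes A: "countable A"
  shows "infsum f A = (\<integral>\<^sup>+x. f x \<partial>count_space A)"
proof (rule antisym)
  have inf: "infsum f A = (SUP F\<in>{F. finite F \<and> F \<subseteq> A}. sum f F)"
    by (rule nonneg_infsum_complete) auto
  show "infsum f A \<le> (\<integral>\<^sup>+x. f x \<partial>count_space A)"
    unfolding inf
  proof (rule SUP_least)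
    fix F assume "F \<in> {F. finite F \<and> F \<subseteq> A}"
    then have F: "finite F" "F \<subseteq> A" by auto
    have "sum f F = (\<integral>\<^sup>+x. f x * indicator F x \<partial>count_space UNIV)"
      using F by (simp add: nn_integral_count_space_finite flip: nn_integral_count_space_indicator)
    also have "\<dots> \<le> (\<integral>\<^sup>+x. f x * indicator A x \<partial>count_space UNIV)"
      using F by (intro nn_integral_mono) (auto simp: indicator_def)
    finally show "sum f F \<le> (\<integral>\<^sup>+x. f x \<partial>count_space A)"
      by (simp add: nn_integral_count_space_indicator)
  qed
  show "(\<integral>\<^sup>+x. f x \<partial>count_space A) \<le> infsum f A"
  proof (cases "finite A")
    case True
    then show ?thesis by (simp add: nn_integral_count_space_finite)
  next
    case False
    then have bij: "bij_betw (from_nat_into A) UNIV A"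
      using A by (rule bij_betw_from_nat_into[rotated])
    have "(\<integral>\<^sup>+x. f x \<partial>count_space A) = (\<Sum>n. f (from_nat_into A n))"
      using nn_integral_bij_count_space[OF bij, of f] by (simp add: nn_integral_count_space_nat)
    also have "\<dots> = (SUP n. \<Sum>i<n. f (from_nat_into A i))"
      by (simp add: suminf_eq_SUP)
    also have "\<dots> \<le> infsum f A"
    proof (rule SUP_least)
      fix n
      have inj: "inj_on (from_nat_into A) {..<n}"
        using bij by (auto simp: bij_betw_def intro: inj_on_subset)
      have "(\<Sum>i<n. f (from_nat_into A i)) = sum f (from_nat_into A ` {..<n})"
        using inj by (simp add: sum.reindex)
      also have "\<dots> \<le> infsum f A"
        unfolding inf using bij by (intro SUP_upper) (auto simp: bij_betw_def)
      finally show "(\<Sum>i<n. f (from_nat_into A i)) \<le> infsum f A" .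
    qed
    finally show ?thesis .
  qed
qed

text \<open>
  The tuples of pairwise different elements of \<open>J\<close> indexed by \<open>P\<close>, extended by \<open>undefined\<close>
  outside \<open>P\<close> so that each tuple is counted once.
\<close>

definition inj_tuples :: "'p set \<Rightarrow> 'i set \<Rightarrow> ('p \<Rightarrow> 'i) set" where
  "inj_tuples P J = {f \<in> P \<rightarrow>\<^sub>E J. inj_on f P}"

lemma finite_inj_tuples: "finite P \<Longrightarrow> finite J \<Longrightarrow> finite (inj_tuples P J)"
  unfolding inj_tuples_def by (rule finite_subset[of _ "P \<rightarrow>\<^sub>E J"]) (auto intro: finite_PiE)

text \<open>
  An injective tuple on \<open>insert q P\<close> is an injective tuple on \<open>P\<close> together with a value at \<open>q\<close> that
  is not yet taken.
\<close>

lemma sum_inj_tuples_insert: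
  fixes c :: "'p \<Rightarrow> 'i \<Rightarrow> real"
  assumes "finite P" "q \<notin> P" "finite J"
  shows "(\<Sum>f\<in>inj_tuples (insert q P) J. \<Prod>p\<in>insert q P. c p (f p))
       = (\<Sum>f\<in>inj_tuples P J. (\<Prod>p\<in>P. c p (f p)) * (\<Sum>j\<in>J - f ` P. c q j))"
proof -
  have "(\<Sum>f\<in>inj_tuples P J. (\<Prod>p\<in>P. c p (f p)) * (\<Sum>j\<in>J - f ` P. c q j))
      = (\<Sum>(f, j)\<in>Sigma (inj_tuples P J) (\<lambda>f. J - f ` P). (\<Prod>p\<in>P. c p (f p)) * c q j)"
    using assms by (simp add: sum_distrib_left sum.Sigma finite_inj_tuples)
  also have "\<dots> = (\<Sum>f\<in>inj_tuples (insert q P) J. \<Prod>p\<in>insert q P. c p (f p))"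
  proof (rule sum.reindex_bij_witness[of _ "\<lambda>f. (restrict f P, f q)" "\<lambda>(f, j). f(q := j)"])
    fix a assume a: "a \<in> Sigma (inj_tuples P J) (\<lambda>f. J - f ` P)"
    obtain f j where [simp]: "a = (f, j)" by force
    have f: "f \<in> P \<rightarrow>\<^sub>E J" "inj_on f P" "j \<in> J" "j \<notin> f ` P"
      using a by (auto simp: inj_tuples_def)
    show "(restrict ((\<lambda>(f, j). f(q := j)) a) P, ((\<lambda>(f, j). f(q := j)) a) q) = a"
      using f assms by (auto simp: restrict_def fun_eq_iff PiE_def extensional_def)
    show "((\<lambda>(f, j). f(q := j)) a) \<in> inj_tuples (insert q P) J"
      using f assms by (auto simp: inj_tuples_def inj_on_fun_updI PiE_def extensional_def)
    show "(\<Prod>p\<in>insert q P. c p (((\<lambda>(f, j). f(q := j)) a) p)) = (case a of (f, j) \<Rightarrow> (\<Prod>p\<in>P. c p (f p)) * c q j)"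
      using assms by (auto simp: mult.commute intro!: prod.cong)
  next
    fix f assume f: "f \<in> inj_tuples (insert q P) J"
    show "(\<lambda>(f, j). f(q := j)) (restrict f P, f q) = f"
      using f by (auto simp: inj_tuples_def restrict_def fun_eq_iff PiE_def extensional_def)
    show "(restrict f P, f q) \<in> Sigma (inj_tuples P J) (\<lambda>f. J - f ` P)"
      using f assms by (auto simp: inj_tuples_def inj_on_def)
  qed
  finally show ?thesis by simp
qed

text \<open>
  If the weights of the individual points tend to zero uniformly, then the tuples with repetitions
  are negligible, and the sum over injective tuples has the same limit as the product of the sums.
\<close>

lemma tendsto_sum_inj_tuples:
  fixes c :: "nat \<Rightarrow> 'p \<Rightarrow> 'i \<Rightarrow> real"
  assumes P: "finite P" and J: "\<And>k. finite (J k)"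
    and nonneg: "\<And>k p i. p \<in> P \<Longrightarrow> i \<in> J k \<Longrightarrow> 0 \<le> c k p i"
    and small: "\<And>k p i. p \<in> P \<Longrightarrow> i \<in> J k \<Longrightarrow> c k p i \<le> e k" and e: "e \<longlonglongrightarrow> 0"
    and T: "\<And>p. p \<in> P \<Longrightarrow> (\<lambda>k. \<Sum>i\<in>J k. c k p i) \<longlonglongrightarrow> T p"
  shows "(\<lambda>k. \<Sum>f\<in>inj_tuples P (J k). \<Prod>p\<in>P. c k p (f p)) \<longlonglongrightarrow> (\<Prod>p\<in>P. T p)"
  using P nonneg small T
proof (induction P rule: finite_induct)
  case empty
  then show ?case by (simp add: inj_tuples_def)
next
  case (insert q P)
  define D where "D = (\<lambda>k. \<Sum>f\<in>inj_tuples P (J k). \<Prod>p\<in>P. c k p (f p))"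
  define E where "E = (\<lambda>k. \<Sum>f\<in>inj_tuples (insert q P) (J k). \<Prod>p\<in>insert q P. c k p (f p))"
  define S where "S = (\<lambda>k. \<Sum>i\<in>J k. c k q i)"
  have D: "D \<longlonglongrightarrow> (\<Prod>p\<in>P. T p)"
    unfolding D_def using insert by (intro insert.IH) auto
  have S: "S \<longlonglongrightarrow> T q" unfolding S_def using insert by auto
  have E: "E k = (\<Sum>f\<in>inj_tuples P (J k). (\<Prod>p\<in>P. c k p (f p)) * (\<Sum>j\<in>J k - f ` P. c k q j))" for k
    unfolding E_def using insert J by (intro sum_inj_tuples_insert) auto
  have pos: "0 \<le> (\<Prod>p\<in>P. c k p (f p))" if "f \<in> inj_tuples P (J k)" for k f
    using that by (intro prod_nonneg insert.prems ballI) (auto simp: inj_tuples_def)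
  have split: "(\<Sum>j\<in>J k - f ` P. c k q j) = S k - (\<Sum>j\<in>f ` P. c k q j)" if "f \<in> inj_tuples P (J k)" for k f
    unfolding S_def using that J by (intro sum_diff) (auto simp: inj_tuples_def)
  have upper: "E k \<le> D k * S k" for k
    unfolding E D_def sum_distrib_right
  proof (intro sum_mono mult_left_mono pos)
    fix f assume f: "f \<in> inj_tuples P (J k)"
    then have "f ` P \<subseteq> J k" by (auto simp: inj_tuples_def)
    then have "0 \<le> (\<Sum>j\<in>f ` P. c k q j)" by (intro sum_nonneg insert.prems) auto
    then show "(\<Sum>j\<in>J k - f ` P. c k q j) \<le> S k" using split[OF f] by simp
  qed
  have lower: "D k * (S k - card P * e k) \<le> E k" for k
    unfolding E D_def sum_distrib_right
  proof (intro sum_mono mult_left_mono pos)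
    fix f assume f: "f \<in> inj_tuples P (J k)"
    then have inj: "inj_on f P" and fJ: "f ` P \<subseteq> J k" by (auto simp: inj_tuples_def)
    have "(\<Sum>j\<in>f ` P. c k q j) \<le> (\<Sum>j\<in>f ` P. e k)"
      using insert.prems(2)[of q _ k] fJ by (intro sum_mono) auto
    also have "\<dots> = card P * e k" using inj by (simp add: card_image)
    finally show "S k - card P * e k \<le> (\<Sum>j\<in>J k - f ` P. c k q j)"
      using split[OF f] by simp
  qed
  have l1: "(\<lambda>k. D k * S k) \<longlonglongrightarrow> (\<Prod>p\<in>P. T p) * T q"
    by (intro tendsto_mult D S)
  have "(\<lambda>k. D k * (S k - card P * e k)) \<longlonglongrightarrow> (\<Prod>p\<in>P. T p) * (T q - real (card P) * 0)"
    by (intro tendsto_intros D S e)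
  then have l2: "(\<lambda>k. D k * (S k - card P * e k)) \<longlonglongrightarrow> (\<Prod>p\<in>P. T p) * T q" by simp
  have "E \<longlonglongrightarrow> (\<Prod>p\<in>P. T p) * T q"
    by (rule tendsto_sandwich[OF _ _ l2 l1]) (simp_all add: upper lower)
  then show ?case unfolding E_def using insert by (simp add: mult.commute)
qed

text \<open>
  Regrouping indices \<open>l\<close> by their class \<open>c l\<close>: a tuple of distinct classes weighted by the sizes of
  the classes is a sum over the index tuples whose members lie in pairwise different classes.
\<close>

lemma sum_inj_tuples_prod_card:
  fixes g :: "'p \<Rightarrow> 'i \<Rightarrow> real"
  assumes P: "finite P" and L: "finite L" and J: "finite J" and c: "c ` L \<subseteq> J"
  shows "(\<Sum>f\<in>inj_tuples P J. \<Prod>p\<in>P. g p (f p) * real (card {l\<in>L. c l = f p}))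
       = (\<Sum>l\<in>P \<rightarrow>\<^sub>E L. if inj_on (\<lambda>p. c (l p)) P then \<Prod>p\<in>P. g p (c (l p)) else 0)"
proof -
  have "(\<Prod>p\<in>P. g p (f p) * real (card {l\<in>L. c l = f p}))
      = (\<Sum>l\<in>P \<rightarrow>\<^sub>E L. \<Prod>p\<in>P. if c (l p) = f p then g p (f p) else 0)" for f
  proof -
    have "g p (f p) * real (card {l\<in>L. c l = f p}) = (\<Sum>l\<in>L. if c l = f p then g p (f p) else 0)" for p
      using L by (simp flip: sum.inter_filter)
    then show ?thesis using P L by (simp add: prod_sum_PiE)
  qed
  then have "(\<Sum>f\<in>inj_tuples P J. \<Prod>p\<in>P. g p (f p) * real (card {l\<in>L. c l = f p}))
      = (\<Sum>l\<in>P \<rightarrow>\<^sub>E L. \<Sum>f\<in>inj_tuples P J. \<Prod>p\<in>P. if c (l p) = f p then g p (f p) else 0)"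
    by (simp, subst sum.swap) simp
  also have "\<dots> = (\<Sum>l\<in>P \<rightarrow>\<^sub>E L. if inj_on (\<lambda>p. c (l p)) P then \<Prod>p\<in>P. g p (c (l p)) else 0)"
  proof (rule sum.cong[OF refl])
    fix l assume l: "l \<in> P \<rightarrow>\<^sub>E L"
    define h where "h = restrict (\<lambda>p. c (l p)) P"
    have "(\<Prod>p\<in>P. if c (l p) = f p then g p (f p) else 0)
        = (if f = h then \<Prod>p\<in>P. g p (c (l p)) else 0)" if "f \<in> inj_tuples P J" for f
    proof (cases "\<forall>p\<in>P. c (l p) = f p")
      case True
      then have "f = h" using that by (auto simp: h_def inj_tuples_def fun_eq_iff PiE_def extensional_def)
      then show ?thesis using True by (auto intro!: prod.cong)
    next
      case False
      then have "f \<noteq> h" by (auto simp: h_def)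
      then show ?thesis using False P by (auto simp: prod_zero_iff)
    qed
    then have "(\<Sum>f\<in>inj_tuples P J. \<Prod>p\<in>P. if c (l p) = f p then g p (f p) else 0)
       = (if h \<in> inj_tuples P J then \<Prod>p\<in>P. g p (c (l p)) else 0)"
      using finite_inj_tuples[OF P J] by (simp add: sum.delta')
    moreover have "h \<in> inj_tuples P J \<longleftrightarrow> inj_on (\<lambda>p. c (l p)) P"
      using l c by (auto simp: h_def inj_tuples_def inj_on_def PiE_def Pi_def image_subset_iff)
    ultimately show "(\<Sum>f\<in>inj_tuples P J. \<Prod>p\<in>P. if c (l p) = f p then g p (f p) else 0)
       = (if inj_on (\<lambda>p. c (l p)) P then \<Prod>p\<in>P. g p (c (l p)) else 0)" by simp
  qed
  finally show ?thesis .
qed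

section \<open>Dyadic discretisation of a summable point configuration\<close>

text \<open>
  The interval of length \<open>1 / 2 ^ K\<close> with left end point \<open>i / 2 ^ K\<close>.
\<close>

definition dyadic_cell :: "nat \<Rightarrow> nat \<Rightarrow> real set" where
  "dyadic_cell K i = {real i / 2 ^ K ..< (real i + 1) / 2 ^ K}"

text \<open>
  The number of the cell of level \<open>K\<close> that contains \<open>x\<close>.
\<close>

definition dyadic_index :: "nat \<Rightarrow> real \<Rightarrow> nat" where
  "dyadic_index K x = nat \<lfloor>2 ^ K * x\<rfloor>"

text \<open>
  The numbers of the cells of level \<open>m + k\<close> that make up the interval from \<open>1 / 2 ^ m\<close> (inclusive) to
  \<open>2 ^ m\<close> (exclusive). With \<open>k = 0\<close> this is the whole range of cells that is used at level \<open>m\<close>;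
  it exhausts the positive half-line as \<open>m\<close> grows.
\<close>

definition dyadic_range :: "nat \<Rightarrow> nat \<Rightarrow> nat set" where
  "dyadic_range m k = {2 ^ k ..< 2 ^ (2 * m + k)}"

lemma finite_dyadic_range [simp]: "finite (dyadic_range m k)"
  by (simp add: dyadic_range_def)

lemma dyadic_range_subset: "dyadic_range m k \<subseteq> dyadic_range (m + k) 0"
proof -
  have "(2::nat) ^ (2 * m + k) \<le> 2 ^ (2 * (m + k))" by (rule power_increasing) auto
  then show ?thesis by (auto simp: dyadic_range_def intro: order_trans[of 1 "2 ^ k"])
qed

lemma dyadic_index_bounds:
  assumes "0 \<le> x"
  shows "real (dyadic_index K x) / 2 ^ K \<le> x" "x < (real (dyadic_index K x) + 1) / 2 ^ K"
proof -
  have "real (dyadic_index K x) = of_int \<lfloor>2 ^ K * x\<rfloor>"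
    using assms by (simp add: dyadic_index_def)
  then have "real (dyadic_index K x) \<le> 2 ^ K * x" "2 ^ K * x < real (dyadic_index K x) + 1"
    by linarith+
  then show "real (dyadic_index K x) / 2 ^ K \<le> x" "x < (real (dyadic_index K x) + 1) / 2 ^ K"
    by (simp_all add: field_simps)
qed

lemma mem_dyadic_cell_iff:
  assumes "0 \<le> x"
  shows "x \<in> dyadic_cell K i \<longleftrightarrow> dyadic_index K x = i"
proof
  assume "x \<in> dyadic_cell K i"
  then have "real i \<le> 2 ^ K * x" "2 ^ K * x < real i + 1"
    by (auto simp: dyadic_cell_def field_simps)
  then have "\<lfloor>2 ^ K * x\<rfloor> = int i" by linarith
  then show "dyadic_index K x = i" by (simp add: dyadic_index_def)
next
  assume "dyadic_index K x = i"
  then show "x \<in> dyadic_cell K i"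
    using dyadic_index_bounds[OF assms, of K] by (auto simp: dyadic_cell_def)
qed

lemma dyadic_index_tendsto:
  assumes "0 \<le> x"
  shows "(\<lambda>k. real (dyadic_index (m + k) x) / 2 ^ (m + k)) \<longlonglongrightarrow> x"
proof (rule tendsto_sandwich)
  show "\<forall>\<^sub>F k in sequentially. x - (1 / 2) ^ (m + k) \<le> real (dyadic_index (m + k) x) / 2 ^ (m + k)"
  proof (rule always_eventually, rule allI)
    fix k
    show "x - (1 / 2) ^ (m + k) \<le> real (dyadic_index (m + k) x) / 2 ^ (m + k)"
      using dyadic_index_bounds(2)[OF assms, of "m + k"]
      by (simp add: add_divide_distrib power_one_over)
  qed
  show "\<forall>\<^sub>F k in sequentially. real (dyadic_index (m + k) x) / 2 ^ (m + k) \<le> x"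
    using dyadic_index_bounds(1)[OF assms] by simp
  have "(\<lambda>k. (1 / 2 :: real) ^ (k + m)) \<longlonglongrightarrow> 0"
    by (rule LIMSEQ_ignore_initial_segment) (simp add: LIMSEQ_power_zero)
  then have "(\<lambda>k. x - (1 / 2) ^ (k + m)) \<longlonglongrightarrow> x - 0" by (intro tendsto_intros)
  then show "(\<lambda>k. x - (1 / 2) ^ (m + k)) \<longlonglongrightarrow> x" by (simp add: add.commute)
qed auto

lemma dyadic_index_mem_range_iff:
  assumes "0 \<le> x"
  shows "dyadic_index (m + k) x \<in> dyadic_range m k \<longleftrightarrow> 1 / 2 ^ m \<le> x \<and> x < 2 ^ m"
proof -
  have "2 ^ k \<le> dyadic_index (m + k) x \<longleftrightarrow> (2::real) ^ k \<le> 2 ^ (m + k) * x"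
    unfolding dyadic_index_def by (simp add: le_nat_iff le_floor_iff)
  also have "\<dots> \<longleftrightarrow> 1 / 2 ^ m \<le> x"
    by (simp add: power_add field_simps)
  finally have 1: "2 ^ k \<le> dyadic_index (m + k) x \<longleftrightarrow> 1 / 2 ^ m \<le> x" .
  have "dyadic_index (m + k) x < 2 ^ (2 * m + k) \<longleftrightarrow> 2 ^ (m + k) * x < 2 ^ (2 * m + k)"
    unfolding dyadic_index_def using assms by (simp add: nat_less_iff floor_less_iff)
  also have "(2::real) ^ (2 * m + k) = 2 ^ (m + k) * 2 ^ m" by (simp flip: power_add add: ac_simps mult_2)
  also have "2 ^ (m + k) * x < 2 ^ (m + k) * 2 ^ m \<longleftrightarrow> x < 2 ^ m"
    by simp
  finally show ?thesis using 1 by (simp add: dyadic_range_def)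
qed

lemma dyadic_cell_midrange:
  assumes "i \<in> dyadic_range m k"
  shows "1 / 2 ^ m \<le> real i / 2 ^ (m + k)" "(real i + 1) / 2 ^ (m + k) \<le> 2 ^ m"
proof -
  have i: "2 ^ k \<le> i" "i + 1 \<le> 2 ^ (2 * m + k)" using assms by (auto simp: dyadic_range_def)
  have "(2::real) ^ k \<le> real i" using of_nat_mono[OF i(1), where ?'a = real] by simp
  then show "1 / 2 ^ m \<le> real i / 2 ^ (m + k)" by (simp add: power_add field_simps)
  have "real i + 1 \<le> 2 ^ (2 * m + k)" using of_nat_mono[OF i(2), where ?'a = real] by simp
  also have "(2::real) ^ (2 * m + k) = 2 ^ (m + k) * 2 ^ m" by (simp flip: power_add add: ac_simps mult_2)
  finally show "(real i + 1) / 2 ^ (m + k) \<le> 2 ^ m" by (simp add: field_simps)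
qed

lemma power_mult_exp_minus_le_fact:
  fixes x :: real assumes "0 \<le> x" shows "x ^ r * exp (- x) \<le> fact r"
proof -
  have "(\<lambda>n. x ^ n / fact n) sums exp x" using exp_converges[of x] by (simp add: field_simps)
  then have "sum (\<lambda>n. x ^ n / fact n) {r} \<le> exp x"
    using assms sum_le_suminf[of "\<lambda>n. x ^ n / fact n" "{r}"] by (simp add: sums_iff)
  then have "x ^ r \<le> exp x * fact r" by (simp add: field_simps)
  then show ?thesis by (simp add: exp_minus field_simps)
qed

text \<open>
  A bound that does not depend on the counts \<open>N\<close>: the tuple sum grows at most polynomially in the
  number of counted points, whereas each of them contributes a factor \<open>exp (- lam * d)\<close> or less. It
  provides the dominating constant when the mesh is refined.
\<close>

lemma tuple_sum_exp_bound:
  fixes g :: "'p \<Rightarrow> 'i \<Rightarrow> real" and N :: "'i \<Rightarrow> nat"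
  assumes P: "finite P" and J: "finite J" and I: "I \<subseteq> J"
    and g: "\<And>p i. p \<in> P \<Longrightarrow> i \<in> I \<Longrightarrow> 0 \<le> g p i \<and> g p i \<le> C"
    and a: "\<And>j. j \<in> J \<Longrightarrow> 0 \<le> a j" and d: "\<And>i. i \<in> I \<Longrightarrow> d \<le> a i" and dpos: "0 < d"
    and C: "0 \<le> C" and lam: "0 < lam"
  shows "(\<Sum>f\<in>inj_tuples P I. \<Prod>p\<in>P. g p (f p) * real (N (f p))) * exp (- lam * (\<Sum>j\<in>J. a j * real (N j)))
         \<le> (C / (lam * d)) ^ card P * fact (card P)"
proof -
  have fI: "finite I" using I J finite_subset by auto
  define n where "n = (\<Sum>i\<in>I. real (N i))"
  have n0: "0 \<le> n" by (auto simp: n_def intro: sum_nonneg)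
  have "(\<Sum>f\<in>inj_tuples P I. \<Prod>p\<in>P. g p (f p) * real (N (f p)))
      \<le> (\<Sum>f\<in>P \<rightarrow>\<^sub>E I. \<Prod>p\<in>P. g p (f p) * real (N (f p)))"
  proof (rule sum_mono2)
    show "finite (P \<rightarrow>\<^sub>E I)" using P fI by (intro finite_PiE) auto
    show "inj_tuples P I \<subseteq> P \<rightarrow>\<^sub>E I" by (auto simp: inj_tuples_def)
    fix f assume "f \<in> (P \<rightarrow>\<^sub>E I) - inj_tuples P I"
    then have "f p \<in> I" if "p \<in> P" for p using that by auto
    then show "0 \<le> (\<Prod>p\<in>P. g p (f p) * real (N (f p)))"
      using g by (intro prod_nonneg ballI mult_nonneg_nonneg) auto
  qed
  also have "\<dots> = (\<Prod>p\<in>P. \<Sum>i\<in>I. g p i * real (N i))"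
    using P fI by (simp add: prod_sum_PiE)
  also have "\<dots> \<le> (\<Prod>p\<in>P. C * n)"
    using g by (intro prod_mono conjI sum_nonneg)
       (auto simp: n_def sum_distrib_left intro!: sum_mono mult_right_mono)
  finally have 1: "(\<Sum>f\<in>inj_tuples P I. \<Prod>p\<in>P. g p (f p) * real (N (f p))) \<le> (C * n) ^ card P"
    by simp
  have "d * n \<le> (\<Sum>j\<in>I. a j * real (N j))"
    unfolding n_def sum_distrib_left using d by (intro sum_mono mult_right_mono) auto
  also have "\<dots> \<le> (\<Sum>j\<in>J. a j * real (N j))"
    using I J a by (intro sum_mono2) auto
  finally have 2: "exp (- lam * (\<Sum>j\<in>J. a j * real (N j))) \<le> exp (- (lam * d * n))"
    using lam by simp
  have "(\<Sum>f\<in>inj_tuples P I. \<Prod>p\<in>P. g p (f p) * real (N (f p))) * exp (- lam * (\<Sum>j\<in>J. a j * real (N j)))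
     \<le> (C * n) ^ card P * exp (- (lam * d * n))"
    using C n0 by (intro mult_mono 1 2) auto
  also have "\<dots> = (C / (lam * d)) ^ card P * ((lam * d * n) ^ card P * exp (- (lam * d * n)))"
  proof -
    have "C * n = C / (lam * d) * (lam * d * n)" using lam dpos by simp
    then show ?thesis by (simp only: power_mult_distrib mult.assoc)
  qed
  also have "\<dots> \<le> (C / (lam * d)) ^ card P * fact (card P)"
    using C lam dpos n0 by (intro mult_left_mono power_mult_exp_minus_le_fact) auto
  finally show ?thesis .
qed

text \<open>
  A sequence of distinct positive points with a finite sum, that is, a typical enumeration of the
  points of the Poisson process.
\<close>

locale summable_points =
  fixes u :: "nat \<Rightarrow> real"
  assumes pos: "\<And>l. 0 < u l" and inj: "inj u" and summable: "summable u"
begin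

lemma card_cell: "card (range u \<inter> dyadic_cell K i) = card {l. dyadic_index K (u l) = i}"
proof -
  have "range u \<inter> dyadic_cell K i = u ` {l. dyadic_index K (u l) = i}"
    using mem_dyadic_cell_iff[OF less_imp_le[OF pos]] by auto
  then show ?thesis using inj by (simp add: card_image inj_on_subset)
qed

lemma finite_ge: "finite {l. 1 / 2 ^ m \<le> u l}"
proof -
  have "u \<longlonglongrightarrow> 0" using summable by (rule summable_LIMSEQ_zero)
  then have "\<forall>\<^sub>F l in sequentially. u l < 1 / 2 ^ m"
    by (rule order_tendstoD) auto
  then obtain N where "\<And>l. l \<ge> N \<Longrightarrow> u l < 1 / 2 ^ m" by (auto simp: eventually_sequentially)
  then have "{l. 1 / 2 ^ m \<le> u l} \<subseteq> {..<N}" by (metis (mono_tags) lessThan_iff mem_Collect_eq not_le subsetI)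
  then show ?thesis by (rule finite_subset) simp
qed

lemma finite_mid: "finite {l. 1 / 2 ^ m \<le> u l \<and> u l < 2 ^ m}"
  by (rule finite_subset[OF _ finite_ge[of m]]) auto

lemma index_mem_iff: "dyadic_index (m + k) (u l) \<in> dyadic_range m k \<longleftrightarrow> 1 / 2 ^ m \<le> u l \<and> u l < 2 ^ m"
  using dyadic_index_mem_range_iff[OF less_imp_le[OF pos]] .

text \<open>
  Rounding every point down to the left end point of its cell, and dropping the points outside the
  range of the level, gives the total sum in the limit.
\<close>

lemma sum_cells_tendsto:
  "(\<lambda>k. \<Sum>j\<in>dyadic_range (m + k) 0. real j / 2 ^ (m + k) * real (card (range u \<inter> dyadic_cell (m + k) j)))
     \<longlonglongrightarrow> (\<Sum>l. u l)"
proof -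
  define a where "a = (\<lambda>l k. if 1 / 2 ^ (m + k) \<le> u l \<and> u l < 2 ^ (m + k)
                             then real (dyadic_index (m + k) (u l)) / 2 ^ (m + k) else 0)"
  have eq: "(\<Sum>j\<in>dyadic_range (m + k) 0. real j / 2 ^ (m + k) * real (card (range u \<inter> dyadic_cell (m + k) j)))
       = (\<Sum>l. a l k)" for k
  proof -
    let ?K = "m + k" and ?J = "dyadic_range (m + k) 0"
    let ?L = "{l. 1 / 2 ^ ?K \<le> u l \<and> u l < 2 ^ ?K}"
    have mem: "dyadic_index ?K (u l) \<in> ?J \<longleftrightarrow> l \<in> ?L" for l
      using index_mem_iff[of "m + k" 0 l] by simp
    have "real j / 2 ^ ?K * real (card (range u \<inter> dyadic_cell ?K j))
       = (\<Sum>l\<in>{l\<in>?L. dyadic_index ?K (u l) = j}. real (dyadic_index ?K (u l)) / 2 ^ ?K)" if "j \<in> ?J" for j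
    proof -
      have "{l. dyadic_index ?K (u l) = j} = {l\<in>?L. dyadic_index ?K (u l) = j}"
        using mem that by blast
      then show ?thesis by (simp add: card_cell)
    qed
    then have "(\<Sum>j\<in>?J. real j / 2 ^ ?K * real (card (range u \<inter> dyadic_cell ?K j)))
      = (\<Sum>j\<in>?J. \<Sum>l\<in>{l\<in>?L. dyadic_index ?K (u l) = j}. real (dyadic_index ?K (u l)) / 2 ^ ?K)"
      by (rule sum.cong[OF refl])
    also have "\<dots> = (\<Sum>l\<in>?L. real (dyadic_index ?K (u l)) / 2 ^ ?K)"
      using mem by (intro sum.group finite_mid) auto
    also have "\<dots> = (\<Sum>l. a l k)"
      by (subst suminf_finite[OF finite_mid[of ?K]]) (auto simp: a_def)
    finally show ?thesis .
  qed
  have lim: "(\<lambda>k. a l k) \<longlonglongrightarrow> u l" for l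
  proof -
    have "\<forall>\<^sub>F k in sequentially. 1 / 2 ^ (m + k) \<le> u l"
    proof -
      have "(\<lambda>k. (1 / 2 :: real) ^ (k + m)) \<longlonglongrightarrow> 0"
        by (rule LIMSEQ_ignore_initial_segment) (simp add: LIMSEQ_power_zero)
      then have "\<forall>\<^sub>F k in sequentially. (1 / 2 :: real) ^ (k + m) < u l"
        using pos by (rule order_tendstoD)
      then show ?thesis by (rule eventually_mono) (simp add: power_one_over add.commute)
    qed
    moreover have "\<forall>\<^sub>F k in sequentially. u l < 2 ^ (m + k)"
    proof -
      obtain n where n: "u l < 2 ^ n" using real_arch_pow[of 2 "u l"] by auto
      have "u l < 2 ^ (m + k)" if "k \<ge> n" for k
      proof -
        have "(2::real) ^ n \<le> 2 ^ (m + k)" using that by (intro power_increasing) auto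
        then show ?thesis using n by linarith
      qed
      then show ?thesis by (auto simp: eventually_sequentially)
    qed
    ultimately have "\<forall>\<^sub>F k in sequentially. real (dyadic_index (m + k) (u l)) / 2 ^ (m + k) = a l k"
      by eventually_elim (simp add: a_def)
    then show ?thesis
      by (rule Lim_transform_eventually[OF dyadic_index_tendsto[OF less_imp_le[OF pos]]])
  qed
  have bound: "norm (a l k) \<le> u l" for l k
    using dyadic_index_bounds(1)[OF less_imp_le[OF pos], of "m + k" l] less_imp_le[OF pos] by (auto simp: a_def)
  have "(\<lambda>k. \<Sum>l. a l k) \<longlonglongrightarrow> (\<Sum>l. u l)"
    using tannerys_theorem[where a = a and F = sequentially, OF lim _ summable] bound
    by (simp add: case_prod_unfold)
  then show ?thesis unfolding eq .
qed

text \<open>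
  Only finitely many points lie in the band of \<open>m\<close>, so distinct points among them are eventually in
  distinct cells. Hence the sum over tuples of distinct cells, weighted by the counts, tends to the
  sum over tuples of distinct points.
\<close>

lemma tuple_sum_tendsto:
  fixes g :: "'p \<Rightarrow> real \<Rightarrow> real"
  assumes P: "finite P" and g: "\<And>p. p \<in> P \<Longrightarrow> continuous_on {0<..} (g p)"
  shows "(\<lambda>k. \<Sum>f\<in>inj_tuples P (dyadic_range m k).
            \<Prod>p\<in>P. g p (real (f p) / 2 ^ (m + k)) * real (card (range u \<inter> dyadic_cell (m + k) (f p))))
         \<longlonglongrightarrow> (\<Sum>l\<in>inj_tuples P {l. 1 / 2 ^ m \<le> u l \<and> u l < 2 ^ m}. \<Prod>p\<in>P. g p (u (l p)))"
proof -
  let ?L = "{l. 1 / 2 ^ m \<le> u l \<and> u l < 2 ^ m}"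
  let ?c = "\<lambda>k l. dyadic_index (m + k) (u l)"
  have eq: "(\<Sum>f\<in>inj_tuples P (dyadic_range m k).
            \<Prod>p\<in>P. g p (real (f p) / 2 ^ (m + k)) * real (card (range u \<inter> dyadic_cell (m + k) (f p))))
       = (\<Sum>l\<in>P \<rightarrow>\<^sub>E ?L. if inj_on (\<lambda>p. ?c k (l p)) P then \<Prod>p\<in>P. g p (real (?c k (l p)) / 2 ^ (m + k)) else 0)" for k
  proof -
    have "{l. ?c k l = i} = {l\<in>?L. ?c k l = i}" if "i \<in> dyadic_range m k" for i
      using that index_mem_iff[of m k] by blast
    then have "(\<Sum>f\<in>inj_tuples P (dyadic_range m k).
            \<Prod>p\<in>P. g p (real (f p) / 2 ^ (m + k)) * real (card (range u \<inter> dyadic_cell (m + k) (f p))))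
        = (\<Sum>f\<in>inj_tuples P (dyadic_range m k).
            \<Prod>p\<in>P. g p (real (f p) / 2 ^ (m + k)) * real (card {l\<in>?L. ?c k l = f p}))"
      unfolding card_cell by (intro sum.cong prod.cong refl) (auto simp: inj_tuples_def PiE_def Pi_def)
    also have "\<dots> = (\<Sum>l\<in>P \<rightarrow>\<^sub>E ?L. if inj_on (\<lambda>p. ?c k (l p)) P then \<Prod>p\<in>P. g p (real (?c k (l p)) / 2 ^ (m + k)) else 0)"
      using index_mem_iff[of m k] P finite_mid
      by (intro sum_inj_tuples_prod_card) auto
    finally show ?thesis .
  qed
  have c_lim: "(\<lambda>k. real (?c k l) / 2 ^ (m + k)) \<longlonglongrightarrow> u l" for l
    by (rule dyadic_index_tendsto[OF less_imp_le[OF pos]])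
  have lim: "(\<lambda>k. if inj_on (\<lambda>p. ?c k (l p)) P then \<Prod>p\<in>P. g p (real (?c k (l p)) / 2 ^ (m + k)) else 0)
     \<longlonglongrightarrow> (if inj_on l P then \<Prod>p\<in>P. g p (u (l p)) else 0)" for l
  proof (cases "inj_on l P")
    case False
    then have "\<not> inj_on (\<lambda>p. ?c k (l p)) P" for k unfolding inj_on_def by metis
    then show ?thesis using False by simp
  next
    case True
    have "\<forall>\<^sub>F k in sequentially. \<forall>p\<in>P. \<forall>q\<in>P. p \<noteq> q \<longrightarrow> ?c k (l p) \<noteq> ?c k (l q)"
    proof (intro eventually_ball_finite P ballI)
      fix p q assume "p \<in> P" "q \<in> P"
      show "\<forall>\<^sub>F k in sequentially. p \<noteq> q \<longrightarrow> ?c k (l p) \<noteq> ?c k (l q)"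
      proof (cases "p = q")
        case False
        then have "u (l p) - u (l q) \<noteq> 0"
          using True inj \<open>p \<in> P\<close> \<open>q \<in> P\<close> by (auto simp: inj_on_def)
        moreover have "(\<lambda>k. real (?c k (l p)) / 2 ^ (m + k) - real (?c k (l q)) / 2 ^ (m + k)) \<longlonglongrightarrow> u (l p) - u (l q)"
          by (intro tendsto_diff c_lim)
        ultimately have "\<forall>\<^sub>F k in sequentially. real (?c k (l p)) / 2 ^ (m + k) - real (?c k (l q)) / 2 ^ (m + k) \<noteq> 0"
          by (intro tendsto_imp_eventually_ne)
        then show ?thesis by (rule eventually_mono) auto
      qed simp
    qed
    then have ev: "\<forall>\<^sub>F k in sequentially. (\<Prod>p\<in>P. g p (real (?c k (l p)) / 2 ^ (m + k)))
       = (if inj_on (\<lambda>p. ?c k (l p)) P then \<Prod>p\<in>P. g p (real (?c k (l p)) / 2 ^ (m + k)) else 0)"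
      by (rule eventually_mono) (auto simp: inj_on_def)
    have "(\<lambda>k. g p (real (?c k (l p)) / 2 ^ (m + k))) \<longlonglongrightarrow> g p (u (l p))" if "p \<in> P" for p
    proof -
      have "isCont (g p) (u (l p))"
        using g[OF that] pos[of "l p"] by (simp add: continuous_on_eq_continuous_at)
      then show ?thesis using c_lim by (rule isCont_tendsto_compose)
    qed
    then have "(\<lambda>k. \<Prod>p\<in>P. g p (real (?c k (l p)) / 2 ^ (m + k))) \<longlonglongrightarrow> (\<Prod>p\<in>P. g p (u (l p)))"
      by (rule tendsto_prod)
    then show ?thesis using True Lim_transform_eventually[OF _ ev] by simp
  qed
  have "(\<Sum>l\<in>inj_tuples P ?L. \<Prod>p\<in>P. g p (u (l p)))
      = (\<Sum>l\<in>P \<rightarrow>\<^sub>E ?L. if inj_on l P then \<Prod>p\<in>P. g p (u (l p)) else 0)"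
    unfolding inj_tuples_def using P finite_mid by (intro sum.inter_filter finite_PiE) auto
  then show ?thesis unfolding eq using lim by (simp add: tendsto_sum)
qed

end

section \<open>The Mecke identity for finitely many disjoint sets\<close>

lemma suminf_ennreal_Suc: "(\<Sum>k. f k) = f 0 + (\<Sum>k. f (Suc k))" for f :: "nat \<Rightarrow> ennreal"
proof (rule LIMSEQ_unique)
  show "(\<lambda>n. \<Sum>k<Suc n. f k) \<longlonglongrightarrow> (\<Sum>k. f k)"
    using summable_LIMSEQ[of f] by (rule LIMSEQ_Suc) simp
  have "(\<lambda>n. f 0 + (\<Sum>k<n. f (Suc k))) \<longlonglongrightarrow> f 0 + (\<Sum>k. f (Suc k))"
    by (intro tendsto_add tendsto_const summable_LIMSEQ) simp
  then show "(\<lambda>n. \<Sum>k<Suc n. f k) \<longlonglongrightarrow> f 0 + (\<Sum>k. f (Suc k))"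
    by (simp only: sum.lessThan_Suc_shift)
qed

locale poisson_process =
  fixes M :: "'w measure" and \<mu> :: "'a measure" and \<Xi> :: "'w \<Rightarrow> 'a set"
  assumes ppp: "poisson_point_process M \<mu> \<Xi>"
begin

sublocale prob_space M
  using ppp by (simp add: poisson_point_process_def)

text \<open>
  The number of points in \<open>A\<close> as a natural number; it is \<open>0\<close> by convention if there are infinitely
  many, which has probability zero when \<open>A\<close> has finite intensity.
\<close>

definition cnt :: "'a set \<Rightarrow> 'w \<Rightarrow> nat" where
  "cnt A \<omega> = card (\<Xi> \<omega> \<inter> A)"

text \<open>
  The value at \<open>\<infinity>\<close> agrees with \<open>card\<close> of an infinite set, so that \<open>cnt\<close> is a function of \<open>point_count\<close>.
\<close>

definition nat_of_enat :: "enat \<Rightarrow> nat" where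
  "nat_of_enat e = (case e of enat k \<Rightarrow> k | \<infinity> \<Rightarrow> 0)"

lemma cnt_eq: "cnt A \<omega> = nat_of_enat (point_count \<Xi> A \<omega>)"
  by (simp add: cnt_def nat_of_enat_def point_count_def)

lemma point_count_measurable: "A \<in> sets \<mu> \<Longrightarrow> point_count \<Xi> A \<in> M \<rightarrow>\<^sub>M count_space UNIV"
  using ppp by (simp add: poisson_point_process_def)

lemma measurable_cnt [measurable]: "A \<in> sets \<mu> \<Longrightarrow> cnt A \<in> M \<rightarrow>\<^sub>M count_space UNIV"
  unfolding cnt_eq[abs_def] by (rule measurable_compose[OF point_count_measurable]) auto

lemma point_count_prob:
  "A \<in> sets \<mu> \<Longrightarrow> emeasure \<mu> A < \<infinity> \<Longrightarrow>
   prob {\<omega>\<in>space M. point_count \<Xi> A \<omega> = enat k} = exp (- measure \<mu> A) * measure \<mu> A ^ k / fact k"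
  using ppp by (simp add: poisson_point_process_def)

lemma AE_finite:
  assumes A: "A \<in> sets \<mu>" "emeasure \<mu> A < \<infinity>"
  shows "AE \<omega> in M. finite (\<Xi> \<omega> \<inter> A)"
proof -
  define F where "F k = {\<omega>\<in>space M. point_count \<Xi> A \<omega> = enat k}" for k
  have F: "F k \<in> events" for k
  proof -
    have "F k = point_count \<Xi> A -` {enat k} \<inter> space M" by (auto simp: F_def)
    then show ?thesis using measurable_sets[OF point_count_measurable[OF A(1)], of "{enat k}"] by simp
  qed
  have "(\<lambda>k. prob (F k)) sums prob (\<Union>k. F k)"
    using F by (intro finite_measure_UNION) (auto simp: disjoint_family_on_def F_def)
  moreover have "(\<lambda>k. prob (F k)) sums 1"
  proof -
    have "(\<lambda>k. exp (- measure \<mu> A) * (measure \<mu> A ^ k /\<^sub>R fact k)) sums (exp (- measure \<mu> A) * exp (measure \<mu> A))"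
      by (intro sums_mult exp_converges)
    then show ?thesis
      using A by (simp add: F_def point_count_prob field_simps flip: exp_add)
  qed
  ultimately have "prob (\<Union>k. F k) = 1" by (rule sums_unique2)
  then have "AE \<omega> in M. \<omega> \<in> (\<Union>k. F k)"
    using F by (intro AE_prob_1) auto
  then show ?thesis
    by (rule AE_mp) (auto simp: F_def point_count_def split: if_splits intro!: AE_I2)
qed

lemma nn_integral_cnt:
  fixes h :: "nat \<Rightarrow> ennreal"
  assumes A: "A \<in> sets \<mu>" "emeasure \<mu> A < \<infinity>"
  shows "(\<integral>\<^sup>+\<omega>. h (cnt A \<omega>) \<partial>M) = (\<Sum>k. h k * ennreal (exp (- measure \<mu> A) * measure \<mu> A ^ k / fact k))"
proof -
  define F where "F k = {\<omega>\<in>space M. point_count \<Xi> A \<omega> = enat k}" for k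
  have F: "F k \<in> events" for k
  proof -
    have "F k = point_count \<Xi> A -` {enat k} \<inter> space M" by (auto simp: F_def)
    then show ?thesis using measurable_sets[OF point_count_measurable[OF A(1)], of "{enat k}"] by simp
  qed
  have "(\<integral>\<^sup>+\<omega>. h (cnt A \<omega>) \<partial>M) = (\<integral>\<^sup>+\<omega>. (\<Sum>k. h k * indicator (F k) \<omega>) \<partial>M)"
  proof (rule nn_integral_cong_AE, use AE_finite[OF A] AE_space in eventually_elim)
    fix \<omega> assume w: "finite (\<Xi> \<omega> \<inter> A)" "\<omega> \<in> space M"
    then have "\<omega> \<in> F k \<longleftrightarrow> k = cnt A \<omega>" for k by (auto simp: F_def point_count_def cnt_def)
    then have "(\<Sum>k. h k * indicator (F k) \<omega>) = (\<Sum>k\<in>{cnt A \<omega>}. h k * indicator (F k) \<omega>)"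
      by (intro suminf_finite) auto
    then show "h (cnt A \<omega>) = (\<Sum>k. h k * indicator (F k) \<omega>)"
      using \<open>\<And>k. \<omega> \<in> F k \<longleftrightarrow> k = cnt A \<omega>\<close> by simp
  qed
  also have "\<dots> = (\<Sum>k. h k * emeasure M (F k))"
    using F by (subst nn_integral_suminf) (auto simp: nn_integral_cmult_indicator)
  finally show ?thesis
    using A by (simp add: emeasure_eq_measure F_def point_count_prob)
qed

text \<open>
  The Chen-Stein identity that characterises the Poisson law.
\<close>

lemma nn_integral_cnt_mult:
  fixes h :: "nat \<Rightarrow> ennreal"
  assumes A: "A \<in> sets \<mu>" "emeasure \<mu> A < \<infinity>"
  shows "(\<integral>\<^sup>+\<omega>. ennreal (real (cnt A \<omega>)) * h (cnt A \<omega>) \<partial>M)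
       = ennreal (measure \<mu> A) * (\<integral>\<^sup>+\<omega>. h (Suc (cnt A \<omega>)) \<partial>M)"
proof -
  let ?m = "measure \<mu> A"
  have *: "ennreal (real (Suc k)) * ennreal (exp (- ?m) * ?m ^ Suc k / fact (Suc k))
      = ennreal ?m * ennreal (exp (- ?m) * ?m ^ k / fact k)" for k
  proof -
    have "real (Suc k) * (exp (- ?m) * ?m ^ Suc k / fact (Suc k)) = ?m * (exp (- ?m) * ?m ^ k / fact k)"
      by (simp del: of_nat_Suc)
    then show ?thesis by (simp only: flip: ennreal_mult'[OF of_nat_0_le_iff] ennreal_mult'[OF measure_nonneg])
  qed
  have "(\<integral>\<^sup>+\<omega>. ennreal (real (cnt A \<omega>)) * h (cnt A \<omega>) \<partial>M)
      = (\<Sum>k. ennreal (real k) * h k * ennreal (exp (- ?m) * ?m ^ k / fact k))"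
    using nn_integral_cnt[OF A, of "\<lambda>k. ennreal (real k) * h k"] .
  also have "\<dots> = (\<Sum>k. ennreal (real (Suc k)) * h (Suc k) * ennreal (exp (- ?m) * ?m ^ Suc k / fact (Suc k)))"
    by (subst suminf_ennreal_Suc) simp
  also have "\<dots> = (\<Sum>k. ennreal ?m * (h (Suc k) * ennreal (exp (- ?m) * ?m ^ k / fact k)))"
  proof (rule arg_cong[where f = suminf], rule ext)
    fix k
    have "ennreal (real (Suc k)) * h (Suc k) * ennreal (exp (- ?m) * ?m ^ Suc k / fact (Suc k))
       = h (Suc k) * (ennreal (real (Suc k)) * ennreal (exp (- ?m) * ?m ^ Suc k / fact (Suc k)))"
      by (simp only: ac_simps)
    then show "ennreal (real (Suc k)) * h (Suc k) * ennreal (exp (- ?m) * ?m ^ Suc k / fact (Suc k))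
      = ennreal ?m * (h (Suc k) * ennreal (exp (- ?m) * ?m ^ k / fact k))"
      unfolding * by (simp only: ac_simps)
  qed
  also have "\<dots> = ennreal ?m * (\<integral>\<^sup>+\<omega>. h (Suc (cnt A \<omega>)) \<partial>M)"
    using nn_integral_cnt[OF A, of "\<lambda>k. h (Suc k)"] by simp
  finally show ?thesis .
qed

lemma nn_integral_cnt_mult_exp:
  assumes A: "A \<in> sets \<mu>" "emeasure \<mu> A < \<infinity>"
  shows "(\<integral>\<^sup>+\<omega>. ennreal (real (cnt A \<omega>) * exp (- c * real (cnt A \<omega>))) \<partial>M)
       = ennreal (exp (- c) * measure \<mu> A) * (\<integral>\<^sup>+\<omega>. ennreal (exp (- c * real (cnt A \<omega>))) \<partial>M)"
proof -
  have "(\<integral>\<^sup>+\<omega>. ennreal (real (cnt A \<omega>) * exp (- c * real (cnt A \<omega>))) \<partial>M)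
     = ennreal (measure \<mu> A) * (\<integral>\<^sup>+\<omega>. ennreal (exp (- c * real (Suc (cnt A \<omega>)))) \<partial>M)"
    using nn_integral_cnt_mult[OF A, of "\<lambda>k. ennreal (exp (- c * real k))"] by (simp add: ennreal_mult')
  also have "(\<integral>\<^sup>+\<omega>. ennreal (exp (- c * real (Suc (cnt A \<omega>)))) \<partial>M)
     = (\<integral>\<^sup>+\<omega>. ennreal (exp (- c)) * ennreal (exp (- c * real (cnt A \<omega>))) \<partial>M)"
    by (intro nn_integral_cong) (simp add: algebra_simps flip: ennreal_mult' exp_add)
  also have "\<dots> = ennreal (exp (- c)) * (\<integral>\<^sup>+\<omega>. ennreal (exp (- c * real (cnt A \<omega>))) \<partial>M)"
    using A by (intro nn_integral_cmult) measurable
  finally show ?thesis by (simp add: ennreal_mult' ac_simps)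
qed

lemma nn_integral_prod_cnt:
  fixes W :: "nat \<Rightarrow> nat \<Rightarrow> ennreal" and A :: "nat \<Rightarrow> 'a set"
  assumes J: "finite J" and A: "A ` J \<subseteq> sets \<mu>" "disjoint_family_on A J"
  shows "(\<integral>\<^sup>+\<omega>. (\<Prod>j\<in>J. W j (cnt (A j) \<omega>)) \<partial>M) = (\<Prod>j\<in>J. \<integral>\<^sup>+\<omega>. W j (cnt (A j) \<omega>) \<partial>M)"
proof (rule indep_vars_nn_integral[OF J])
  have "indep_vars (\<lambda>_. count_space UNIV) (\<lambda>j. point_count \<Xi> (A j)) J"
    using ppp J A by (simp add: poisson_point_process_def)
  then show "indep_vars (\<lambda>_. borel) (\<lambda>j \<omega>. W j (cnt (A j) \<omega>)) J"
    unfolding cnt_eq by (rule indep_vars_compose2) auto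
qed auto

text \<open>
  The factors \<open>exp (- lam * a j * cnt (A j))\<close> are independent. Those with \<open>j\<close> in the range of \<open>f\<close>
  carry an additional factor \<open>cnt (A j)\<close>, which comes out as \<open>exp (- lam * a j) * measure \<mu> (A j)\<close>.
\<close>

lemma tuple_count_mecke:
  fixes A :: "nat \<Rightarrow> 'a set"
  assumes P: "finite P" and J: "finite J" and A: "A ` J \<subseteq> sets \<mu>" "disjoint_family_on A J"
    and fin: "\<And>j. j \<in> J \<Longrightarrow> emeasure \<mu> (A j) < \<infinity>" and f: "f \<in> inj_tuples P J"
  shows "(\<integral>\<^sup>+\<omega>. ennreal ((\<Prod>p\<in>P. real (cnt (A (f p)) \<omega>)) * exp (- lam * (\<Sum>j\<in>J. a j * real (cnt (A j) \<omega>)))) \<partial>M)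
       = ennreal (\<Prod>p\<in>P. exp (- lam * a (f p)) * measure \<mu> (A (f p)))
         * (\<integral>\<^sup>+\<omega>. ennreal (exp (- lam * (\<Sum>j\<in>J. a j * real (cnt (A j) \<omega>)))) \<partial>M)"
proof -
  have fJ: "f ` P \<subseteq> J" and inj: "inj_on f P" using f by (auto simp: inj_tuples_def)
  define V where "V j N = ennreal (exp (- (lam * a j) * real N))" for j N
  define W where "W j N = ennreal ((if j \<in> f ` P then real N else 1) * exp (- (lam * a j) * real N))" for j N
  have pull: "(\<Prod>j\<in>J. if j \<in> f ` P then h j else 1) = (\<Prod>p\<in>P. h (f p))" for h :: "nat \<Rightarrow> real"
  proof -
    have "(\<Prod>j\<in>J. if j \<in> f ` P then h j else 1) = (\<Prod>j\<in>f ` P. h j)"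
      using fJ J by (simp add: prod.If_cases Int_absorb1)
    then show ?thesis using inj by (simp add: prod.reindex)
  qed
  have exp_prod: "exp (- lam * (\<Sum>j\<in>J. a j * real (N j))) = (\<Prod>j\<in>J. exp (- (lam * a j) * real (N j)))" for N
    using J by (simp add: exp_sum sum_distrib_left mult.assoc sum_negf[symmetric])
  have "(\<integral>\<^sup>+\<omega>. ennreal ((\<Prod>p\<in>P. real (cnt (A (f p)) \<omega>)) * exp (- lam * (\<Sum>j\<in>J. a j * real (cnt (A j) \<omega>)))) \<partial>M)
     = (\<integral>\<^sup>+\<omega>. (\<Prod>j\<in>J. W j (cnt (A j) \<omega>)) \<partial>M)"
  proof (rule nn_integral_cong)
    fix \<omega>
    have "(\<Prod>p\<in>P. real (cnt (A (f p)) \<omega>)) * exp (- lam * (\<Sum>j\<in>J. a j * real (cnt (A j) \<omega>)))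
        = (\<Prod>j\<in>J. (if j \<in> f ` P then real (cnt (A j) \<omega>) else 1) * exp (- (lam * a j) * real (cnt (A j) \<omega>)))"
      unfolding exp_prod prod.distrib pull ..
    then show "ennreal ((\<Prod>p\<in>P. real (cnt (A (f p)) \<omega>)) * exp (- lam * (\<Sum>j\<in>J. a j * real (cnt (A j) \<omega>))))
      = (\<Prod>j\<in>J. W j (cnt (A j) \<omega>))"
      by (simp add: W_def prod_ennreal)
  qed
  also have "\<dots> = (\<Prod>j\<in>J. \<integral>\<^sup>+\<omega>. W j (cnt (A j) \<omega>) \<partial>M)"
    by (rule nn_integral_prod_cnt[OF J A])
  also have "\<dots> = (\<Prod>j\<in>J. ennreal (if j \<in> f ` P then exp (- (lam * a j)) * measure \<mu> (A j) else 1)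
                          * (\<integral>\<^sup>+\<omega>. V j (cnt (A j) \<omega>) \<partial>M))"
  proof (rule prod.cong[OF refl])
    fix j assume j: "j \<in> J"
    show "(\<integral>\<^sup>+\<omega>. W j (cnt (A j) \<omega>) \<partial>M) = ennreal (if j \<in> f ` P then exp (- (lam * a j)) * measure \<mu> (A j) else 1)
                          * (\<integral>\<^sup>+\<omega>. V j (cnt (A j) \<omega>) \<partial>M)"
    proof (cases "j \<in> f ` P")
      case True
      then show ?thesis
        using nn_integral_cnt_mult_exp[of "A j" "lam * a j"] fin[OF j] A(1) j
        by (simp only: W_def V_def if_True) auto
    next
      case False
      then show ?thesis by (simp only: W_def V_def if_False) simp
    qed
  qed
  also have "\<dots> = ennreal (\<Prod>j\<in>J. if j \<in> f ` P then exp (- (lam * a j)) * measure \<mu> (A j) else 1)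
                  * (\<Prod>j\<in>J. \<integral>\<^sup>+\<omega>. V j (cnt (A j) \<omega>) \<partial>M)"
    by (simp add: prod.distrib prod_ennreal)
  also have "(\<Prod>j\<in>J. \<integral>\<^sup>+\<omega>. V j (cnt (A j) \<omega>) \<partial>M) = (\<integral>\<^sup>+\<omega>. (\<Prod>j\<in>J. V j (cnt (A j) \<omega>)) \<partial>M)"
    by (rule nn_integral_prod_cnt[OF J A, symmetric])
  also have "\<dots> = (\<integral>\<^sup>+\<omega>. ennreal (exp (- lam * (\<Sum>j\<in>J. a j * real (cnt (A j) \<omega>)))) \<partial>M)"
    unfolding exp_prod V_def by (simp add: prod_ennreal)
  finally show ?thesis unfolding pull by simp
qed

lemma tuple_sum_mecke:
  fixes A :: "nat \<Rightarrow> 'a set"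
  assumes P: "finite P" and J: "finite J" and A: "A ` J \<subseteq> sets \<mu>" "disjoint_family_on A J"
    and fin: "\<And>j. j \<in> J \<Longrightarrow> emeasure \<mu> (A j) < \<infinity>" and I: "I \<subseteq> J"
    and g: "\<And>p i. p \<in> P \<Longrightarrow> i \<in> I \<Longrightarrow> 0 \<le> g p i"
  shows "(\<integral>\<^sup>+\<omega>. ennreal ((\<Sum>f\<in>inj_tuples P I. \<Prod>p\<in>P. g p (f p) * real (cnt (A (f p)) \<omega>))
                         * exp (- lam * (\<Sum>j\<in>J. a j * real (cnt (A j) \<omega>)))) \<partial>M)
       = ennreal (\<Sum>f\<in>inj_tuples P I. \<Prod>p\<in>P. g p (f p) * (exp (- lam * a (f p)) * measure \<mu> (A (f p))))
         * (\<integral>\<^sup>+\<omega>. ennreal (exp (- lam * (\<Sum>j\<in>J. a j * real (cnt (A j) \<omega>)))) \<partial>M)"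
proof -
  define G where "G f = (\<Prod>p\<in>P. g p (f p))" for f
  define X where "X \<omega> = exp (- lam * (\<Sum>j\<in>J. a j * real (cnt (A j) \<omega>)))" for \<omega>
  have sub: "inj_tuples P I \<subseteq> inj_tuples P J" using I by (auto simp: inj_tuples_def)
  have G: "0 \<le> G f" if "f \<in> inj_tuples P I" for f
    unfolding G_def using that g by (intro prod_nonneg) (auto simp: inj_tuples_def PiE_def Pi_def)
  have [measurable]: "j \<in> J \<Longrightarrow> A j \<in> sets \<mu>" for j using A by auto
  have X[measurable]: "X \<in> borel_measurable M" unfolding X_def by measurable
  have m[measurable]: "(\<lambda>\<omega>. (\<Prod>p\<in>P. real (cnt (A (f p)) \<omega>)) * X \<omega>) \<in> borel_measurable M" if "f \<in> inj_tuples P I" for f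
  proof -
    have "p \<in> P \<Longrightarrow> f p \<in> J" for p using that sub by (auto simp: inj_tuples_def)
    then show ?thesis by measurable
  qed
  have "(\<integral>\<^sup>+\<omega>. ennreal ((\<Sum>f\<in>inj_tuples P I. \<Prod>p\<in>P. g p (f p) * real (cnt (A (f p)) \<omega>)) * X \<omega>) \<partial>M)
     = (\<integral>\<^sup>+\<omega>. (\<Sum>f\<in>inj_tuples P I. ennreal (G f) * ennreal ((\<Prod>p\<in>P. real (cnt (A (f p)) \<omega>)) * X \<omega>)) \<partial>M)"
  proof (rule nn_integral_cong)
    fix \<omega>
    have "(\<Sum>f\<in>inj_tuples P I. \<Prod>p\<in>P. g p (f p) * real (cnt (A (f p)) \<omega>)) * X \<omega>
       = (\<Sum>f\<in>inj_tuples P I. G f * ((\<Prod>p\<in>P. real (cnt (A (f p)) \<omega>)) * X \<omega>))"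
      by (simp add: sum_distrib_right prod.distrib G_def mult.assoc)
    moreover have "ennreal \<dots> = (\<Sum>f\<in>inj_tuples P I. ennreal (G f * ((\<Prod>p\<in>P. real (cnt (A (f p)) \<omega>)) * X \<omega>)))"
      using G by (intro sum_ennreal[symmetric]) (auto simp: X_def intro!: mult_nonneg_nonneg prod_nonneg)
    ultimately show "ennreal ((\<Sum>f\<in>inj_tuples P I. \<Prod>p\<in>P. g p (f p) * real (cnt (A (f p)) \<omega>)) * X \<omega>)
       = (\<Sum>f\<in>inj_tuples P I. ennreal (G f) * ennreal ((\<Prod>p\<in>P. real (cnt (A (f p)) \<omega>)) * X \<omega>))"
      using G by (simp add: ennreal_mult')
  qed
  also have "\<dots> = (\<Sum>f\<in>inj_tuples P I. ennreal (G f) * (\<integral>\<^sup>+\<omega>. ennreal ((\<Prod>p\<in>P. real (cnt (A (f p)) \<omega>)) * X \<omega>) \<partial>M))"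
    using m by (subst nn_integral_sum) (auto simp: nn_integral_cmult)
  also have "\<dots> = (\<Sum>f\<in>inj_tuples P I. ennreal (G f) * (ennreal (\<Prod>p\<in>P. exp (- lam * a (f p)) * measure \<mu> (A (f p)))
        * (\<integral>\<^sup>+\<omega>. ennreal (X \<omega>) \<partial>M)))"
  proof (rule sum.cong[OF refl])
    fix f assume "f \<in> inj_tuples P I"
    then have "f \<in> inj_tuples P J" using sub by auto
    from tuple_count_mecke[OF P J A fin this, of lam a]
    show "ennreal (G f) * (\<integral>\<^sup>+\<omega>. ennreal ((\<Prod>p\<in>P. real (cnt (A (f p)) \<omega>)) * X \<omega>) \<partial>M)
       = ennreal (G f) * (ennreal (\<Prod>p\<in>P. exp (- lam * a (f p)) * measure \<mu> (A (f p))) * (\<integral>\<^sup>+\<omega>. ennreal (X \<omega>) \<partial>M))"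
      by (simp add: X_def)
  qed
  also have "\<dots> = (\<Sum>f\<in>inj_tuples P I. ennreal (\<Prod>p\<in>P. g p (f p) * (exp (- lam * a (f p)) * measure \<mu> (A (f p)))))
        * (\<integral>\<^sup>+\<omega>. ennreal (X \<omega>) \<partial>M)"
    unfolding sum_distrib_right
    using G by (intro sum.cong refl) (simp add: prod.distrib G_def ennreal_mult'' prod_nonneg flip: mult.assoc)
  also have "(\<Sum>f\<in>inj_tuples P I. ennreal (\<Prod>p\<in>P. g p (f p) * (exp (- lam * a (f p)) * measure \<mu> (A (f p)))))
     = ennreal (\<Sum>f\<in>inj_tuples P I. \<Prod>p\<in>P. g p (f p) * (exp (- lam * a (f p)) * measure \<mu> (A (f p))))"
    using g by (intro sum_ennreal prod_nonneg) (auto simp: inj_tuples_def PiE_def Pi_def)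
  finally show ?thesis unfolding X_def .
qed

end

section \<open>The intensity measure of the Poisson-Dirichlet process\<close>

text \<open>
  The union of the cells numbered by \<open>dyadic_range m k\<close>, for any \<open>k\<close>; a set of finite intensity on
  which the points of the process are bounded away from \<open>0\<close> and from infinity.
\<close>

definition dyadic_band :: "nat \<Rightarrow> real set" where
  "dyadic_band m = {1 / 2 ^ m ..< 2 ^ m}"

lemma dyadic_band_pos: "x \<in> dyadic_band m \<Longrightarrow> 0 < x"
  by (auto simp: dyadic_band_def intro: less_le_trans[rotated])

lemma dyadic_band_borel [measurable]: "dyadic_band m \<in> sets borel"
  by (simp add: dyadic_band_def)

lemma dyadic_cell_borel [measurable]: "dyadic_cell K i \<in> sets borel"
  by (simp add: dyadic_cell_def)

lemma dyadic_cell_subset_band: "i \<in> dyadic_range m k \<Longrightarrow> dyadic_cell (m + k) i \<subseteq> dyadic_band m"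
  using dyadic_cell_midrange[of i m k] by (auto simp: dyadic_cell_def dyadic_band_def)

lemma disjoint_dyadic_cells: "disjoint_family_on (dyadic_cell K) J"
  unfolding disjoint_family_on_def
proof (intro ballI impI)
  fix i j :: nat assume "i \<noteq> j"
  have "0 \<le> x" if "x \<in> dyadic_cell K i" for x
    using that by (auto simp: dyadic_cell_def intro: order_trans[rotated])
  then show "dyadic_cell K i \<inter> dyadic_cell K j = {}"
    using \<open>i \<noteq> j\<close> mem_dyadic_cell_iff by fastforce
qed

lemma dyadic_band_exhausts:
  assumes "0 < x" shows "\<exists>N. \<forall>m\<ge>N. x \<in> dyadic_band m"
proof -
  obtain a where a: "x < 2 ^ a" using real_arch_pow[of 2 x] by auto
  obtain b where b: "1 / x < 2 ^ b" using real_arch_pow[of 2 "1 / x"] by auto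
  have "x \<in> dyadic_band m" if m: "m \<ge> a" "m \<ge> b" for m
  proof -
    have "(2::real) ^ a \<le> 2 ^ m" "(2::real) ^ b \<le> 2 ^ m"
      using m by (auto intro: power_increasing)
    then have "x < 2 ^ m" "1 / x < 2 ^ m" using a b by linarith+
    then show ?thesis using assms by (simp add: dyadic_band_def field_simps)
  qed
  then show ?thesis by (intro exI[of _ "max a b"]) auto
qed

lemma incseq_dyadic_band: "m \<le> n \<Longrightarrow> dyadic_band m \<subseteq> dyadic_band n"
proof -
  assume "m \<le> n"
  then have "(2::real) ^ m \<le> 2 ^ n" by (auto intro: power_increasing)
  moreover from this have "1 / (2::real) ^ n \<le> 1 / 2 ^ m" by (simp add: field_simps)
  ultimately show ?thesis by (auto simp: dyadic_band_def)
qed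

lemma sets_PD_intensity: "sets (PD_intensity \<zeta>) = {A. A \<subseteq> {0<..} \<and> A \<in> sets borel}"
  by (auto simp: PD_intensity_def sets_restrict_space_iff)

lemma space_PD_intensity: "space (PD_intensity \<zeta>) = {0<..}"
  by (simp add: PD_intensity_def space_restrict_space)

lemma measurable_PD_intensity [measurable (raw)]:
  assumes "f \<in> borel_measurable borel" shows "f \<in> borel_measurable (PD_intensity \<zeta>)"
  unfolding PD_intensity_def using assms by (simp add: measurable_restrict_space1)

lemma nn_integral_PD_intensity:
  assumes [measurable]: "f \<in> borel_measurable borel"
  shows "(\<integral>\<^sup>+x. f x \<partial>PD_intensity \<zeta>)
       = (\<integral>\<^sup>+x. ennreal (x powr (- 1 - \<zeta>)) * f x * indicator {0<..} x \<partial>lborel)"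
  unfolding PD_intensity_def
  by (subst nn_integral_density) (auto simp: nn_integral_restrict_space intro!: measurable_restrict_space1)

lemma emeasure_PD_intensity_le:
  assumes a: "0 < a" "a \<le> b" and z: "0 < \<zeta>"
  shows "emeasure (PD_intensity \<zeta>) {a..<b} \<le> ennreal ((b - a) * a powr (- 1 - \<zeta>))"
proof -
  have "emeasure (PD_intensity \<zeta>) {a..<b} = (\<integral>\<^sup>+x. indicator {a..<b} x \<partial>PD_intensity \<zeta>)"
    using a by (subst nn_integral_indicator) (auto simp: sets_PD_intensity)
  also have "\<dots> = (\<integral>\<^sup>+x. ennreal (x powr (- 1 - \<zeta>)) * indicator {a..<b} x * indicator {0<..} x \<partial>lborel)"
    by (rule nn_integral_PD_intensity) simp
  also have "\<dots> \<le> (\<integral>\<^sup>+x. ennreal (a powr (- 1 - \<zeta>)) * indicator {a..<b} x \<partial>lborel)"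
    using a z by (intro nn_integral_mono)
      (auto simp: indicator_def intro!: ennreal_leI powr_mono2')
  also have "\<dots> = ennreal (a powr (- 1 - \<zeta>)) * ennreal (b - a)"
    using a by (subst nn_integral_cmult_indicator) auto
  also have "\<dots> = ennreal ((b - a) * a powr (- 1 - \<zeta>))"
    using a by (simp add: ennreal_mult' mult.commute)
  finally show ?thesis .
qed

lemma emeasure_dyadic_band_finite: "0 < \<zeta> \<Longrightarrow> emeasure (PD_intensity \<zeta>) (dyadic_band m) < \<infinity>"
proof -
  assume "0 < \<zeta>"
  have "1 / (2::real) ^ m \<le> 1" by simp
  moreover have "(1::real) \<le> 2 ^ m" by simp
  ultimately have "1 / (2::real) ^ m \<le> 2 ^ m" by (rule order_trans)
  then have "emeasure (PD_intensity \<zeta>) (dyadic_band m) \<le> ennreal ((2 ^ m - 1 / 2 ^ m) * (1 / 2 ^ m) powr (- 1 - \<zeta>))"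
    unfolding dyadic_band_def using \<open>0 < \<zeta>\<close> by (intro emeasure_PD_intensity_le) auto
  then show ?thesis by (rule le_less_trans) simp
qed

lemma dyadic_cell_sets:
  assumes "i \<in> dyadic_range m k"
  shows "dyadic_cell (m + k) i \<in> sets (PD_intensity \<zeta>)"
  using dyadic_cell_subset_band[OF assms] dyadic_band_pos by (auto simp: sets_PD_intensity)

lemma dyadic_band_sets: "dyadic_band m \<in> sets (PD_intensity \<zeta>)"
  using dyadic_band_pos by (auto simp: sets_PD_intensity)

lemma emeasure_dyadic_cell:
  assumes "i \<in> dyadic_range m k" "0 < \<zeta>"
  shows "emeasure (PD_intensity \<zeta>) (dyadic_cell (m + k) i) < \<infinity>"
  using emeasure_mono[OF dyadic_cell_subset_band[OF assms(1)] dyadic_band_sets]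
    emeasure_dyadic_band_finite[OF assms(2)] by (rule le_less_trans)

lemma measure_dyadic_cell_le:
  assumes i: "i \<in> dyadic_range m k" and z: "0 < \<zeta>"
  shows "measure (PD_intensity \<zeta>) (dyadic_cell (m + k) i) \<le> (1 / 2) ^ (m + k) * (1 / 2 ^ m) powr (- 1 - \<zeta>)"
proof -
  let ?a = "real i / 2 ^ (m + k)"
  have a: "1 / 2 ^ m \<le> ?a" by (rule dyadic_cell_midrange[OF i])
  then have a0: "0 < ?a" by (rule less_le_trans[rotated]) simp
  have "(real i + 1) / 2 ^ (m + k) = ?a + (1 / 2) ^ (m + k)"
    by (simp add: add_divide_distrib power_one_over)
  then have cell: "dyadic_cell (m + k) i = {?a ..< ?a + (1 / 2) ^ (m + k)}" by (simp add: dyadic_cell_def)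
  have "emeasure (PD_intensity \<zeta>) (dyadic_cell (m + k) i)
      \<le> ennreal ((?a + (1 / 2) ^ (m + k) - ?a) * ?a powr (- 1 - \<zeta>))"
    unfolding cell using a0 z by (intro emeasure_PD_intensity_le) auto
  also have "\<dots> \<le> ennreal ((1 / 2) ^ (m + k) * (1 / 2 ^ m) powr (- 1 - \<zeta>))"
  proof (rule ennreal_leI)
    have "?a powr (- 1 - \<zeta>) \<le> (1 / 2 ^ m) powr (- 1 - \<zeta>)" using a z by (intro powr_mono2') auto
    then show "(?a + (1 / 2) ^ (m + k) - ?a) * ?a powr (- 1 - \<zeta>) \<le> (1 / 2) ^ (m + k) * (1 / 2 ^ m) powr (- 1 - \<zeta>)"
      by simp
  qed
  finally show ?thesis
    using emeasure_eq_ennreal_measure[of "PD_intensity \<zeta>" "dyadic_cell (m + k) i"]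
      emeasure_dyadic_cell[OF i z] by (simp add: less_top)
qed

lemma riemann_sum_PD_intensity:
  fixes G :: "real \<Rightarrow> real"
  assumes z: "0 < \<zeta>" and G: "continuous_on {0<..} G" and meas [measurable]: "G \<in> borel_measurable borel"
    and C: "0 \<le> C" and bound: "\<And>x. x \<in> dyadic_band m \<Longrightarrow> 0 \<le> G x \<and> G x \<le> C"
  obtains T where "0 \<le> T" "ennreal T = (\<integral>\<^sup>+x. ennreal (G x) * indicator (dyadic_band m) x \<partial>PD_intensity \<zeta>)"
    "(\<lambda>k. \<Sum>i\<in>dyadic_range m k. G (real i / 2 ^ (m + k)) * measure (PD_intensity \<zeta>) (dyadic_cell (m + k) i)) \<longlonglongrightarrow> T"
proof -
  let ?\<mu> = "PD_intensity \<zeta>" and ?I = "\<lambda>k. dyadic_range m k"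
  define D where "D k x = real (dyadic_index (m + k) x) / 2 ^ (m + k)" for k x
  have Gpos: "0 \<le> G (real i / 2 ^ (m + k))" "G (real i / 2 ^ (m + k)) \<le> C" if i: "i \<in> ?I k" for i k
  proof -
    have "real i / 2 ^ (m + k) \<in> dyadic_cell (m + k) i"
      by (auto simp: dyadic_cell_def divide_strict_right_mono)
    then show "0 \<le> G (real i / 2 ^ (m + k))" "G (real i / 2 ^ (m + k)) \<le> C"
      using dyadic_cell_subset_band[OF i] bound by auto
  qed
  define U where "U k x = (\<Sum>i\<in>?I k. ennreal (G (real i / 2 ^ (m + k))) * indicator (dyadic_cell (m + k) i) x)" for k x
  have U_eq: "U k x = ennreal (G (D k x)) * indicator (dyadic_band m) x" if x: "x \<in> space ?\<mu>" for k x
  proof -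
    have x0: "0 \<le> x" using x by (simp add: space_PD_intensity)
    have "U k x = (\<Sum>i\<in>?I k. if i = dyadic_index (m + k) x then ennreal (G (real i / 2 ^ (m + k))) else 0)"
      unfolding U_def by (intro sum.cong refl) (auto simp: indicator_def mem_dyadic_cell_iff[OF x0])
    also have "\<dots> = ennreal (G (D k x)) * indicator (dyadic_band m) x"
      using dyadic_index_mem_range_iff[OF x0, of m k] by (auto simp: D_def dyadic_band_def indicator_def)
    finally show ?thesis .
  qed
  define S where "S k = (\<Sum>i\<in>?I k. G (real i / 2 ^ (m + k)) * measure ?\<mu> (dyadic_cell (m + k) i))" for k
  have cell_em: "emeasure ?\<mu> (dyadic_cell (m + k) i) = ennreal (measure ?\<mu> (dyadic_cell (m + k) i))" if "i \<in> ?I k" for i k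
    using emeasure_dyadic_cell[OF that z] by (intro emeasure_eq_ennreal_measure) auto
  have S_eq: "ennreal (S k) = (\<integral>\<^sup>+x. U k x \<partial>?\<mu>)" for k
  proof -
    have "(\<integral>\<^sup>+x. U k x \<partial>?\<mu>) = (\<Sum>i\<in>?I k. ennreal (G (real i / 2 ^ (m + k))) * emeasure ?\<mu> (dyadic_cell (m + k) i))"
      unfolding U_def using dyadic_cell_sets
      by (subst nn_integral_sum) (auto simp: nn_integral_cmult_indicator intro!: measurable_PD_intensity)
    also have "\<dots> = (\<Sum>i\<in>?I k. ennreal (G (real i / 2 ^ (m + k)) * measure ?\<mu> (dyadic_cell (m + k) i)))"
      using Gpos by (intro sum.cong refl) (simp add: cell_em ennreal_mult')
    also have "\<dots> = ennreal (S k)"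
      unfolding S_def using Gpos by (intro sum_ennreal) auto
    finally show ?thesis by simp
  qed
  let ?f = "\<lambda>x. ennreal (G x) * indicator (dyadic_band m) x"
  have w: "(\<integral>\<^sup>+x. ennreal C * indicator (dyadic_band m) x \<partial>?\<mu>) < \<infinity>"
    using emeasure_dyadic_band_finite[OF z, of m] dyadic_band_sets
    by (simp add: nn_integral_cmult_indicator ennreal_mult_less_top)
  have conv: "(\<lambda>k. ennreal (S k)) \<longlonglongrightarrow> (\<integral>\<^sup>+x. ?f x \<partial>?\<mu>)"
    unfolding S_eq
  proof (rule nn_integral_dominated_convergence[OF _ _ _ _ w])
    show "U k \<in> borel_measurable ?\<mu>" for k unfolding U_def by (intro measurable_PD_intensity) measurable
    show "?f \<in> borel_measurable ?\<mu>" by (intro measurable_PD_intensity) measurable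
    show "(\<lambda>x. ennreal C * indicator (dyadic_band m) x) \<in> borel_measurable ?\<mu>"
      by (intro measurable_PD_intensity) measurable
    show "AE x in ?\<mu>. U k x \<le> ennreal C * indicator (dyadic_band m) x" for k
    proof (rule AE_I2)
      fix x assume x: "x \<in> space ?\<mu>"
      show "U k x \<le> ennreal C * indicator (dyadic_band m) x"
      proof (cases "x \<in> dyadic_band m")
        case True
        then have "dyadic_index (m + k) x \<in> ?I k"
          using dyadic_index_mem_range_iff[of x m k] dyadic_band_pos[OF True] by (simp add: dyadic_band_def)
        then show ?thesis using True Gpos(2) unfolding U_eq[OF x] D_def by (simp add: ennreal_leI)
      qed (simp add: U_eq[OF x])
    qed
    show "AE x in ?\<mu>. (\<lambda>k. U k x) \<longlonglongrightarrow> ?f x"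
    proof (rule AE_I2)
      fix x assume x: "x \<in> space ?\<mu>"
      then have x0: "0 < x" by (simp add: space_PD_intensity)
      then have "isCont G x" using G by (simp add: continuous_on_eq_continuous_at)
      moreover have "(\<lambda>k. D k x) \<longlonglongrightarrow> x"
        unfolding D_def using x0 by (intro dyadic_index_tendsto) simp
      ultimately have "(\<lambda>k. G (D k x)) \<longlonglongrightarrow> G x" by (rule isCont_tendsto_compose)
      then show "(\<lambda>k. U k x) \<longlonglongrightarrow> ?f x"
        unfolding U_eq[OF x] by (cases "x \<in> dyadic_band m") (auto intro: tendsto_ennrealI)
    qed
  qed
  have "(\<integral>\<^sup>+x. ?f x \<partial>?\<mu>) \<le> (\<integral>\<^sup>+x. ennreal C * indicator (dyadic_band m) x \<partial>?\<mu>)"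
    using bound by (intro nn_integral_mono) (auto simp: indicator_def intro!: ennreal_leI)
  then have "(\<integral>\<^sup>+x. ?f x \<partial>?\<mu>) < top" using w by simp
  then obtain T where T: "0 \<le> T" "(\<integral>\<^sup>+x. ?f x \<partial>?\<mu>) = ennreal T"
    by (cases "\<integral>\<^sup>+x. ?f x \<partial>?\<mu>") auto
  have "S \<longlonglongrightarrow> T"
    using conv T Gpos by (intro tendsto_ennrealD) (auto simp: S_def intro!: always_eventually sum_nonneg)
  then show ?thesis using that T unfolding S_def by simp
qed

section \<open>Summability of the points\<close>

text \<open>
  A Poisson process with intensity \<open>PD_intensity \<zeta>\<close> together with its decreasing enumeration.
\<close>

locale pd_process = poisson_process M "PD_intensity \<zeta>" \<Xi>
  for M :: "'w measure" and \<zeta> :: real and \<Xi> :: "'w \<Rightarrow> real set" +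
  fixes u :: "nat \<Rightarrow> 'w \<Rightarrow> real"
  assumes enum: "decreasing_enumeration M \<Xi> u" and zeta: "0 < \<zeta>" "\<zeta> < 1"
begin

lemma measurable_u [measurable]: "u l \<in> borel_measurable M"
  using enum by (simp add: decreasing_enumeration_def)

lemma points_subset: "\<omega> \<in> space M \<Longrightarrow> \<Xi> \<omega> \<subseteq> {0<..}"
  using ppp by (auto simp: poisson_point_process_def space_PD_intensity)

lemma AE_enum: "AE \<omega> in M. (\<forall>k l. k < l \<longrightarrow> u l \<omega> < u k \<omega>) \<and> range (\<lambda>l. u l \<omega>) = \<Xi> \<omega>"
  using enum by (simp add: decreasing_enumeration_def)

text \<open>
  The shells partition the open unit interval.
\<close>

definition shell :: "nat \<Rightarrow> real set" where
  "shell i = {1 / 2 ^ Suc i ..< 1 / 2 ^ i}"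

lemma shell_sets: "shell i \<in> sets (PD_intensity \<zeta>)"
  by (auto simp: shell_def sets_PD_intensity intro: less_le_trans[rotated])

lemma emeasure_shell_le:
  "emeasure (PD_intensity \<zeta>) (shell i) \<le> ennreal ((1 / 2) ^ Suc i * ((1 / 2) ^ Suc i) powr (- 1 - \<zeta>))"
proof -
  have "emeasure (PD_intensity \<zeta>) (shell i)
     \<le> ennreal ((1 / 2 ^ i - 1 / 2 ^ Suc i) * (1 / 2 ^ Suc i) powr (- 1 - \<zeta>))"
    unfolding shell_def using zeta by (intro emeasure_PD_intensity_le) (auto simp: field_simps)
  also have "1 / (2::real) ^ i - 1 / 2 ^ Suc i = (1 / 2) ^ Suc i" by (simp add: field_simps)
  finally show ?thesis by (simp add: power_one_over)
qed

lemma shell_finite: "emeasure (PD_intensity \<zeta>) (shell i) < \<infinity>"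
  using emeasure_shell_le by (rule le_less_trans) simp

text \<open>
  The expectation is at most a geometric series with ratio \<open>(1 / 2) powr (1 - \<zeta>)\<close>, which converges
  because \<open>\<zeta> < 1\<close>.
\<close>

lemma AE_shell_sum: "AE \<omega> in M. (\<Sum>i. ennreal ((1 / 2) ^ i) * ennreal (real (cnt (shell i) \<omega>))) \<noteq> \<infinity>"
proof (rule nn_integral_noteq_infinite)
  have [measurable]: "shell i \<in> sets (PD_intensity \<zeta>)" for i by (rule shell_sets)
  show "(\<lambda>\<omega>. \<Sum>i. ennreal ((1 / 2) ^ i) * ennreal (real (cnt (shell i) \<omega>))) \<in> borel_measurable M"
    by measurable
  have E: "(\<integral>\<^sup>+\<omega>. ennreal (real (cnt (shell i) \<omega>)) \<partial>M) = ennreal (measure (PD_intensity \<zeta>) (shell i))" for i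
    using nn_integral_cnt_mult[OF shell_sets shell_finite, of i "\<lambda>_. 1"] by (simp add: emeasure_space_1)
  define q where "q = (1 / 2) powr (1 - \<zeta>)"
  have q: "0 \<le> q" "q < 1"
    using zeta powr_less_mono2[of "1 - \<zeta>" "1 / 2" 1] by (auto simp: q_def)
  have term_le: "ennreal ((1 / 2) ^ i) * ennreal (measure (PD_intensity \<zeta>) (shell i)) \<le> ennreal (2 * q ^ Suc i)" for i
  proof -
    have "(1 / 2) ^ i * ((1 / 2) ^ Suc i * ((1 / 2) ^ Suc i) powr (- 1 - \<zeta>)) = 2 * q ^ Suc i"
    proof -
      have "((1 / 2) ^ Suc i) powr (1 - \<zeta>) = q ^ Suc i"
      proof -
        have "(x ^ n) powr c = (x powr c) ^ n" if "0 \<le> x" for x c :: real and n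
          using that by (induction n) (simp_all add: powr_mult)
        from this[of "1 / 2" "Suc i"] show ?thesis unfolding q_def by simp
      qed
      moreover have "x powr (1 - \<zeta>) = x powr (- 1 - \<zeta>) * x\<^sup>2" if "0 < x" for x :: real
        using powr_add[of x "- 1 - \<zeta>" 2] that by (simp add: powr_numeral)
      from this[of "(1 / 2) ^ Suc i"]
      have "((1 / 2) ^ Suc i) powr (1 - \<zeta>) = ((1 / 2) ^ Suc i) powr (- 1 - \<zeta>) * ((1 / 2) ^ Suc i)\<^sup>2"
        by simp
      ultimately show ?thesis by (simp add: power2_eq_square field_simps)
    qed
    moreover have "ennreal (measure (PD_intensity \<zeta>) (shell i)) \<le> ennreal ((1 / 2) ^ Suc i * ((1 / 2) ^ Suc i) powr (- 1 - \<zeta>))"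
      using emeasure_shell_le[of i] shell_finite[of i] by (simp add: emeasure_eq_ennreal_measure less_top)
    then have "ennreal ((1 / 2) ^ i) * ennreal (measure (PD_intensity \<zeta>) (shell i))
      \<le> ennreal ((1 / 2) ^ i) * ennreal ((1 / 2) ^ Suc i * ((1 / 2) ^ Suc i) powr (- 1 - \<zeta>))"
      by (rule mult_left_mono) simp
    ultimately show ?thesis by (simp flip: ennreal_mult')
  qed
  have "(\<integral>\<^sup>+\<omega>. (\<Sum>i. ennreal ((1 / 2) ^ i) * ennreal (real (cnt (shell i) \<omega>))) \<partial>M)
     = (\<Sum>i. ennreal ((1 / 2) ^ i) * ennreal (measure (PD_intensity \<zeta>) (shell i)))"
    by (subst nn_integral_suminf) (auto simp: nn_integral_cmult E)
  also have "\<dots> \<le> (\<Sum>i. ennreal (2 * q ^ Suc i))"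
    by (intro suminf_le term_le) auto
  also have "\<dots> = ennreal (\<Sum>i. 2 * q ^ Suc i)"
    using q by (intro suminf_ennreal2 summable_mult) (auto intro!: summable_mult summable_geometric)
  also have "\<dots> < \<infinity>" by simp
  finally show "(\<integral>\<^sup>+\<omega>. (\<Sum>i. ennreal ((1 / 2) ^ i) * ennreal (real (cnt (shell i) \<omega>))) \<partial>M) \<noteq> \<infinity>" by simp
qed

lemma AE_band_finite: "AE \<omega> in M. \<forall>m. finite (\<Xi> \<omega> \<inter> dyadic_band m)"
  using AE_finite[OF dyadic_band_sets emeasure_dyadic_band_finite[OF zeta(1)]] by (simp add: AE_all_countable)

lemma shell_subset_band: "shell i \<subseteq> dyadic_band (Suc i)"
proof -
  have "1 / (2::real) ^ i \<le> 1" by simp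
  also have "1 \<le> (2::real) ^ Suc i" by (rule one_le_power) simp
  finally show ?thesis by (auto simp: shell_def dyadic_band_def)
qed

lemma ex_shell:
  assumes "0 < x" "x < 1" shows "\<exists>i. x \<in> shell i"
proof -
  obtain n where "(1 / 2) ^ n < x" using real_arch_pow_inv[of x "1/2"] assms by auto
  then have ex: "\<exists>i. 1 / 2 ^ Suc i \<le> x"
    by (intro exI[of _ n]) (auto simp: power_one_over field_simps)
  define i where "i = (LEAST i. 1 / 2 ^ Suc i \<le> x)"
  have 1: "1 / 2 ^ Suc i \<le> x" unfolding i_def using ex by (rule LeastI_ex)
  have "x < 1 / 2 ^ i"
  proof (cases i)
    case (Suc j)
    then have "\<not> 1 / 2 ^ Suc j \<le> x" using not_less_Least[of j "\<lambda>i. 1 / 2 ^ Suc i \<le> x"] by (simp add: i_def)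
    then show ?thesis using Suc by simp
  qed (use assms in simp)
  then show ?thesis using 1 by (auto simp: shell_def)
qed

lemma AE_summable_points: "AE \<omega> in M. summable_points (\<lambda>l. u l \<omega>) \<and> range (\<lambda>l. u l \<omega>) = \<Xi> \<omega>"
  using AE_shell_sum AE_band_finite AE_enum AE_space
proof eventually_elim
  case (elim \<omega>)
  let ?u = "\<lambda>l. u l \<omega>"
  have ran: "range ?u = \<Xi> \<omega>" and dec: "\<And>k l. k < l \<Longrightarrow> ?u l < ?u k" using elim by auto
  have pos: "0 < ?u l" for l using points_subset[OF elim(4)] ran by auto
  have inj: "inj ?u" using dec by (intro linorder_injI) force
  have fin_shell: "finite (\<Xi> \<omega> \<inter> shell i)" for i
    using elim(2) shell_subset_band by (meson finite_subset inf_mono order_refl)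
  obtain C where C: "(\<Sum>i. ennreal ((1 / 2) ^ i) * ennreal (real (cnt (shell i) \<omega>))) = ennreal C" "0 \<le> C"
    using elim(1) by (cases "\<Sum>i. ennreal ((1 / 2) ^ i) * ennreal (real (cnt (shell i) \<omega>))") auto
  define v where "v l = (if ?u l < 1 then ?u l else 0)" for l
  have "(\<Sum>l<n. v l) \<le> C" for n
  proof -
    have "ennreal (\<Sum>l<n. v l) = (\<Sum>l<n. ennreal (v l))"
      using pos by (intro sum_ennreal[symmetric]) (auto simp: v_def less_imp_le)
    also have "\<dots> \<le> (\<Sum>l<n. \<Sum>i. ennreal ((1 / 2) ^ i) * indicator (shell i) (?u l))"
    proof (rule sum_mono)
      fix l
      show "ennreal (v l) \<le> (\<Sum>i. ennreal ((1 / 2) ^ i) * indicator (shell i) (?u l))"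
      proof (cases "?u l < 1")
        case True
        then obtain i where i: "?u l \<in> shell i" using ex_shell pos by blast
        have "ennreal (v l) \<le> ennreal ((1 / 2) ^ i) * indicator (shell i) (?u l)"
          using i True by (auto simp: v_def shell_def power_one_over intro!: ennreal_leI)
        also have "\<dots> \<le> (\<Sum>i. ennreal ((1 / 2) ^ i) * indicator (shell i) (?u l))"
        proof -
          have "f i \<le> suminf f" for f :: "nat \<Rightarrow> ennreal" using sum_le_suminf[of f "{i}"] by simp
          then show ?thesis .
        qed
        finally show ?thesis .
      qed (simp add: v_def)
    qed
    also have "\<dots> = (\<Sum>i. \<Sum>l<n. ennreal ((1 / 2) ^ i) * indicator (shell i) (?u l))"
      by (intro suminf_sum[symmetric]) auto
    also have "\<dots> \<le> (\<Sum>i. ennreal ((1 / 2) ^ i) * ennreal (real (cnt (shell i) \<omega>)))"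
    proof (intro suminf_le)
      fix i
      have "(\<Sum>l<n. indicator (shell i) (?u l) :: ennreal) = of_nat (card {l\<in>{..<n}. ?u l \<in> shell i})"
        by (simp add: indicator_def sum.If_cases Int_def)
      also have "card {l\<in>{..<n}. ?u l \<in> shell i} = card (?u ` {l\<in>{..<n}. ?u l \<in> shell i})"
        using inj by (intro card_image[symmetric]) (auto intro: inj_on_subset)
      also have "of_nat \<dots> \<le> (of_nat (cnt (shell i) \<omega>) :: ennreal)"
        unfolding cnt_def using fin_shell ran by (intro of_nat_mono card_mono) auto
      finally show "(\<Sum>l<n. ennreal ((1 / 2) ^ i) * indicator (shell i) (?u l))
         \<le> ennreal ((1 / 2) ^ i) * ennreal (real (cnt (shell i) \<omega>))"
        by (simp add: ennreal_of_nat_eq_real_of_nat mult_left_mono flip: sum_distrib_left)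
    qed auto
    finally show ?thesis using C by simp
  qed
  then have sv: "summable v"
    using pos by (intro summableI_nonneg_bounded[of v C]) (auto simp: v_def less_imp_le)
  have "finite {l. \<not> ?u l < 1}"
  proof -
    obtain N where N: "\<And>m. m \<ge> N \<Longrightarrow> ?u 0 \<in> dyadic_band m" using dyadic_band_exhausts[OF pos] by blast
    have "?u ` {l. \<not> ?u l < 1} \<subseteq> \<Xi> \<omega> \<inter> dyadic_band N"
    proof (rule image_subsetI)
      fix l assume "l \<in> {l. \<not> ?u l < 1}"
      then have "1 \<le> ?u l" by auto
      moreover have "?u l \<le> ?u 0" using dec[of 0 l] by (cases "l = 0") auto
      moreover from \<open>1 \<le> ?u l\<close> have "1 / (2::real) ^ N \<le> ?u l" by (rule order_trans[rotated]) simp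
      ultimately show "?u l \<in> \<Xi> \<omega> \<inter> dyadic_band N"
        using N[of N] ran by (auto simp: dyadic_band_def)
    qed
    then have "finite (?u ` {l. \<not> ?u l < 1})" using elim(2) finite_subset by blast
    then show ?thesis using inj by (auto dest: finite_imageD intro: inj_on_subset)
  qed
  then have "summable (\<lambda>l. if l \<in> {l. \<not> ?u l < 1} then ?u l else 0)"
    by (rule summable_If_finite_set)
  with sv have "summable (\<lambda>l. v l + (if l \<in> {l. \<not> ?u l < 1} then ?u l else 0))"
    by (rule summable_add)
  moreover have "v l + (if l \<in> {l. \<not> ?u l < 1} then ?u l else 0) = ?u l" for l by (simp add: v_def)
  ultimately have "summable ?u" by simp
  then show ?case using pos inj ran by (auto intro: summable_points.intro)
qed

end

section \<open>The Mecke identity with exponential tilting\<close>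

lemma countable_inj_tuples: "finite P \<Longrightarrow> countable J \<Longrightarrow> countable (inj_tuples P J)"
  unfolding inj_tuples_def by (rule countable_subset[of _ "P \<rightarrow>\<^sub>E J"]) (auto intro: countable_PiE)

lemma borel_measurable_nn_integral_count_space:
  fixes f :: "'i \<Rightarrow> 'w \<Rightarrow> ennreal"
  assumes I: "countable I" and f: "\<And>i. i \<in> I \<Longrightarrow> f i \<in> borel_measurable M"
  shows "(\<lambda>\<omega>. \<integral>\<^sup>+i. f i \<omega> \<partial>count_space I) \<in> borel_measurable M"
proof -
  interpret sigma_finite_measure "count_space I" using I by (rule sigma_finite_measure_count_space_countable)
  have "case_prod f \<in> borel_measurable (count_space I \<Otimes>\<^sub>M M)"
    using I f by (intro measurable_pair_measure_countable1) auto
  then have "(\<lambda>(\<omega>, i). f i \<omega>) \<in> borel_measurable (M \<Otimes>\<^sub>M count_space I)"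
    by (rule measurable_pair_swap[of "case_prod f", simplified])
  then show ?thesis by (intro borel_measurable_nn_integral) simp
qed

lemma tendsto_prod_ennreal:
  fixes f :: "'p \<Rightarrow> nat \<Rightarrow> ennreal"
  assumes "finite P" "\<And>p. p \<in> P \<Longrightarrow> f p \<longlonglongrightarrow> T p" "\<And>p. p \<in> P \<Longrightarrow> T p < \<infinity>"
  shows "(\<lambda>n. \<Prod>p\<in>P. f p n) \<longlonglongrightarrow> (\<Prod>p\<in>P. T p) \<and> (\<Prod>p\<in>P. T p) < \<infinity>"
  using assms
proof (induction P rule: finite_induct)
  case (insert q P)
  then have IH: "(\<lambda>n. \<Prod>p\<in>P. f p n) \<longlonglongrightarrow> (\<Prod>p\<in>P. T p)" "(\<Prod>p\<in>P. T p) < \<infinity>" by auto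
  have "(\<lambda>n. f q n * (\<Prod>p\<in>P. f p n)) \<longlonglongrightarrow> T q * (\<Prod>p\<in>P. T p)"
    using insert.prems IH(2) by (intro tendsto_mult_ennreal IH(1)) (auto simp: less_top)
  then show ?case using insert IH by (simp add: ennreal_mult_less_top)
qed simp

context pd_process
begin

text \<open>
  The Mecke identity for tuples with all members in the band of \<open>m\<close>. The identity for counts in dyadic
  cells passes to the limit of vanishing mesh: the left-hand side by bounded convergence, the right-hand side
  because the sum over tuples of distinct cells is asymptotically a product of Riemann sums.
\<close>

lemma mecke_band:
  fixes g :: "'p \<Rightarrow> real \<Rightarrow> real"
  assumes P: "finite P" and cont: "\<And>p. p \<in> P \<Longrightarrow> continuous_on {0<..} (g p)"
    and meas: "\<And>p. p \<in> P \<Longrightarrow> g p \<in> borel_measurable borel"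
    and nonneg: "\<And>p x. p \<in> P \<Longrightarrow> 0 < x \<Longrightarrow> 0 \<le> g p x" and lam: "0 < lam"
  shows "(\<integral>\<^sup>+\<omega>. \<integral>\<^sup>+l. ennreal ((\<Prod>p\<in>P. g p (u (l p) \<omega>) * indicator (dyadic_band m) (u (l p) \<omega>))
              * exp (- lam * (\<Sum>j. u j \<omega>))) \<partial>count_space (inj_tuples P UNIV) \<partial>M)
       = (\<Prod>p\<in>P. \<integral>\<^sup>+x. ennreal (g p x * exp (- lam * x)) * indicator (dyadic_band m) x \<partial>PD_intensity \<zeta>)
         * (\<integral>\<^sup>+\<omega>. ennreal (exp (- lam * (\<Sum>j. u j \<omega>))) \<partial>M)"
proof -
  let ?\<mu> = "PD_intensity \<zeta>" and ?I = "dyadic_range m" and ?J = "\<lambda>k. dyadic_range (m + k) 0"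
  let ?a = "\<lambda>k i. real i / 2 ^ (m + k)" and ?c = "\<lambda>k i. dyadic_cell (m + k) i"
  obtain C where C: "0 \<le> C" "\<And>p x. p \<in> P \<Longrightarrow> x \<in> dyadic_band m \<Longrightarrow> g p x \<le> C"
  proof -
    have "\<exists>B. \<forall>x\<in>dyadic_band m. norm (g p x) \<le> B" if p: "p \<in> P" for p
    proof -
      have sub: "{1 / 2 ^ m .. 2 ^ m} \<subseteq> {0::real<..}" by (auto intro: less_le_trans[rotated])
      have "compact (g p ` {1 / 2 ^ m .. 2 ^ m})"
        using continuous_on_subset[OF cont[OF p] sub] by (intro compact_continuous_image) auto
      then obtain B where "\<forall>y\<in>g p ` {1 / 2 ^ m .. 2 ^ m}. norm y \<le> B"
        using compact_imp_bounded bounded_iff by metis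
      then show ?thesis by (intro exI[of _ B]) (auto simp: dyadic_band_def)
    qed
    then obtain B where B: "\<And>p x. p \<in> P \<Longrightarrow> x \<in> dyadic_band m \<Longrightarrow> norm (g p x) \<le> B p" by metis
    have "g p x \<le> (\<Sum>p\<in>P. \<bar>B p\<bar>)" if "p \<in> P" "x \<in> dyadic_band m" for p x
      using B[OF that] member_le_sum[of p P "\<lambda>p. \<bar>B p\<bar>"] that P by auto
    then show ?thesis by (intro that[of "\<Sum>p\<in>P. \<bar>B p\<bar>"]) (auto intro: sum_nonneg)
  qed
  have a_band: "?a k i \<in> dyadic_band m" if "i \<in> ?I k" for k i
    using dyadic_cell_subset_band[OF that] by (auto simp: dyadic_cell_def divide_strict_right_mono)
  have g_bd: "0 \<le> g p (?a k i) \<and> g p (?a k i) \<le> C" if "p \<in> P" "i \<in> ?I k" for p k i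
    using C(2) nonneg a_band[OF that(2)] dyadic_band_pos that by blast

  \<comment> \<open>\<open>V\<close> and \<open>F\<close> are the discretised exponential and tuple sum, \<open>S\<close> is the tuple sum with intensities in place of counts.\<close>
  define V where "V k \<omega> = exp (- lam * (\<Sum>j\<in>?J k. ?a k j * real (cnt (?c k j) \<omega>)))" for k \<omega>
  define F where "F k \<omega> = (\<Sum>f\<in>inj_tuples P (?I k). \<Prod>p\<in>P. g p (?a k (f p)) * real (cnt (?c k (f p)) \<omega>))" for k \<omega>
  define S where "S k = (\<Sum>f\<in>inj_tuples P (?I k). \<Prod>p\<in>P. g p (?a k (f p)) * (exp (- lam * ?a k (f p)) * measure ?\<mu> (?c k (f p))))" for k
  define U where "U \<omega> = (\<Sum>j. u j \<omega>)" for \<omega>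
  define H where "H \<omega> = (\<integral>\<^sup>+l. ennreal ((\<Prod>p\<in>P. g p (u (l p) \<omega>) * indicator (dyadic_band m) (u (l p) \<omega>))
              * exp (- lam * U \<omega>)) \<partial>count_space (inj_tuples P UNIV))" for \<omega>
  have J_sets: "?c k j \<in> sets ?\<mu>" "emeasure ?\<mu> (?c k j) < \<infinity>" if "j \<in> ?J k" for k j
    using dyadic_cell_sets[of j "m + k" 0] emeasure_dyadic_cell[of j "m + k" 0] zeta that by auto
  have sub: "?I k \<subseteq> ?J k" for k by (rule dyadic_range_subset)
  have [measurable]: "U \<in> borel_measurable M" unfolding U_def by measurable
  have V_meas [measurable]: "V k \<in> borel_measurable M" for k
  proof -
    have [measurable]: "j \<in> ?J k \<Longrightarrow> cnt (?c k j) \<in> M \<rightarrow>\<^sub>M count_space UNIV" for j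
      using J_sets by (intro measurable_cnt) auto
    show ?thesis unfolding V_def by measurable
  qed
  have F_meas [measurable]: "F k \<in> borel_measurable M" for k
    unfolding F_def
  proof (intro borel_measurable_sum borel_measurable_prod borel_measurable_times)
    fix f p assume "f \<in> inj_tuples P (?I k)" "p \<in> P"
    then have "f p \<in> ?J k" using sub[of k] by (auto simp: inj_tuples_def)
    then have [measurable]: "cnt (?c k (f p)) \<in> M \<rightarrow>\<^sub>M count_space UNIV"
      using J_sets by (intro measurable_cnt) auto
    show "(\<lambda>\<omega>. real (cnt (?c k (f p)) \<omega>)) \<in> borel_measurable M" by measurable
  qed auto
  have H_meas: "H \<in> borel_measurable M"
    unfolding H_def
  proof (intro borel_measurable_nn_integral_count_space countable_inj_tuples P)
    fix l :: "'p \<Rightarrow> nat"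
    show "(\<lambda>\<omega>. ennreal ((\<Prod>p\<in>P. g p (u (l p) \<omega>) * indicator (dyadic_band m) (u (l p) \<omega>)) * exp (- lam * U \<omega>))) \<in> borel_measurable M"
      using meas by (intro measurable_compose[OF _ measurable_ennreal] borel_measurable_times borel_measurable_prod
          measurable_compose[OF measurable_u]) auto
  qed auto
  have mecke: "(\<integral>\<^sup>+\<omega>. ennreal (F k \<omega> * V k \<omega>) \<partial>M) = ennreal (S k) * (\<integral>\<^sup>+\<omega>. ennreal (V k \<omega>) \<partial>M)" for k
    unfolding F_def V_def S_def
    using J_sets g_bd by (intro tuple_sum_mecke P disjoint_dyadic_cells sub) auto

  have AE_lim: "AE \<omega> in M. (\<lambda>k. ennreal (F k \<omega> * V k \<omega>)) \<longlonglongrightarrow> H \<omega> \<and> (\<lambda>k. ennreal (V k \<omega>)) \<longlonglongrightarrow> ennreal (exp (- lam * U \<omega>))"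
    using AE_summable_points
  proof eventually_elim
    case (elim \<omega>)
    interpret summable_points "\<lambda>l. u l \<omega>" using elim by simp
    let ?L = "{l. 1 / 2 ^ m \<le> u l \<omega> \<and> u l \<omega> < 2 ^ m}"
    have ran: "range (\<lambda>l. u l \<omega>) = \<Xi> \<omega>" using elim by simp
    have V: "(\<lambda>k. V k \<omega>) \<longlonglongrightarrow> exp (- lam * U \<omega>)"
      unfolding V_def U_def cnt_def using sum_cells_tendsto[of m] unfolding ran by (intro tendsto_intros)
    have F: "(\<lambda>k. F k \<omega>) \<longlonglongrightarrow> (\<Sum>l\<in>inj_tuples P ?L. \<Prod>p\<in>P. g p (u (l p) \<omega>))"
      unfolding F_def cnt_def using tuple_sum_tendsto[OF P cont, where m = m] unfolding ran by auto
    have "H \<omega> = (\<Sum>l\<in>inj_tuples P ?L. ennreal ((\<Prod>p\<in>P. g p (u (l p) \<omega>) * indicator (dyadic_band m) (u (l p) \<omega>)) * exp (- lam * U \<omega>)))"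
      unfolding H_def
    proof (rule nn_integral_count_space')
      show "finite (inj_tuples P ?L)" using P finite_mid by (rule finite_inj_tuples)
      show "inj_tuples P ?L \<subseteq> inj_tuples P UNIV" by (auto simp: inj_tuples_def)
      fix l :: "'p \<Rightarrow> nat" assume "l \<in> inj_tuples P UNIV" "l \<notin> inj_tuples P ?L"
      then obtain p where "p \<in> P" "u (l p) \<omega> \<notin> dyadic_band m"
        by (auto simp: inj_tuples_def dyadic_band_def PiE_def Pi_def)
      then have "(\<Prod>p\<in>P. g p (u (l p) \<omega>) * indicator (dyadic_band m) (u (l p) \<omega>)) = 0"
        using P by (intro prod_zero bexI[of _ p]) auto
      then show "ennreal ((\<Prod>p\<in>P. g p (u (l p) \<omega>) * indicator (dyadic_band m) (u (l p) \<omega>)) * exp (- lam * U \<omega>)) = 0"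
        by simp
    qed
    also have "\<dots> = (\<Sum>l\<in>inj_tuples P ?L. ennreal ((\<Prod>p\<in>P. g p (u (l p) \<omega>)) * exp (- lam * U \<omega>)))"
    proof (rule sum.cong[OF refl])
      fix l assume l: "l \<in> inj_tuples P ?L"
      have "(\<Prod>p\<in>P. g p (u (l p) \<omega>) * indicator (dyadic_band m) (u (l p) \<omega>)) = (\<Prod>p\<in>P. g p (u (l p) \<omega>))"
        using l by (intro prod.cong refl) (auto simp: inj_tuples_def dyadic_band_def PiE_def Pi_def)
      then show "ennreal ((\<Prod>p\<in>P. g p (u (l p) \<omega>) * indicator (dyadic_band m) (u (l p) \<omega>)) * exp (- lam * U \<omega>))
          = ennreal ((\<Prod>p\<in>P. g p (u (l p) \<omega>)) * exp (- lam * U \<omega>))" by simp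
    qed
    also have "\<dots> = ennreal ((\<Sum>l\<in>inj_tuples P ?L. \<Prod>p\<in>P. g p (u (l p) \<omega>)) * exp (- lam * U \<omega>))"
      unfolding sum_distrib_right using nonneg pos
      by (intro sum_ennreal mult_nonneg_nonneg prod_nonneg) auto
    finally have H: "H \<omega> = ennreal ((\<Sum>l\<in>inj_tuples P ?L. \<Prod>p\<in>P. g p (u (l p) \<omega>)) * exp (- lam * U \<omega>))" .
    show ?case unfolding H by (intro conjI tendsto_ennrealI tendsto_mult F V)
  qed

  define K where "K = (C / (lam * (1 / 2 ^ m))) ^ card P * fact (card P)"
  have bound: "F k \<omega> * V k \<omega> \<le> K" for k \<omega>
    unfolding F_def V_def K_def
    using g_bd C(1) lam dyadic_cell_midrange(1)
    by (intro tuple_sum_exp_bound P sub) auto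
  have lhs: "(\<lambda>k. \<integral>\<^sup>+\<omega>. ennreal (F k \<omega> * V k \<omega>) \<partial>M) \<longlonglongrightarrow> (\<integral>\<^sup>+\<omega>. H \<omega> \<partial>M)"
  proof (rule nn_integral_dominated_convergence[where w = "\<lambda>_. ennreal K"])
    show "AE \<omega> in M. ennreal (F k \<omega> * V k \<omega>) \<le> ennreal K" for k
      using bound by (intro AE_I2 ennreal_leI)
    show "(\<integral>\<^sup>+\<omega>. ennreal K \<partial>M) < \<infinity>" by (simp add: emeasure_space_1)
    show "AE \<omega> in M. (\<lambda>k. ennreal (F k \<omega> * V k \<omega>)) \<longlonglongrightarrow> H \<omega>" using AE_lim by eventually_elim simp
  qed (use H_meas in auto)
  have V_le: "V k \<omega> \<le> 1" for k \<omega>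
    using lam by (auto simp: V_def intro!: mult_nonneg_nonneg sum_nonneg)
  have V_lim: "(\<lambda>k. \<integral>\<^sup>+\<omega>. ennreal (V k \<omega>) \<partial>M) \<longlonglongrightarrow> (\<integral>\<^sup>+\<omega>. ennreal (exp (- lam * U \<omega>)) \<partial>M)"
  proof (rule nn_integral_dominated_convergence[where w = "\<lambda>_. 1"])
    show "AE \<omega> in M. ennreal (V k \<omega>) \<le> 1" for k using V_le by (intro AE_I2) (simp add: ennreal_le_1)
    show "(\<integral>\<^sup>+\<omega>. 1 \<partial>M) < \<infinity>" by (simp add: emeasure_space_1)
    show "AE \<omega> in M. (\<lambda>k. ennreal (V k \<omega>)) \<longlonglongrightarrow> ennreal (exp (- lam * U \<omega>))" using AE_lim by eventually_elim simp
  qed auto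
  have V_fin: "(\<integral>\<^sup>+\<omega>. ennreal (exp (- lam * U \<omega>)) \<partial>M) < \<infinity>"
  proof -
    have "(\<integral>\<^sup>+\<omega>. ennreal (V k \<omega>) \<partial>M) \<le> (\<integral>\<^sup>+\<omega>. 1 \<partial>M)" for k
      using V_le by (intro nn_integral_mono) (simp add: ennreal_le_1)
    then have "(\<integral>\<^sup>+\<omega>. ennreal (exp (- lam * U \<omega>)) \<partial>M) \<le> 1"
      using V_lim by (intro LIMSEQ_le_const2) (auto simp: emeasure_space_1)
    then show ?thesis by (rule le_less_trans) simp
  qed

  define G where "G p x = g p x * exp (- lam * x)" for p x
  have "\<exists>T. 0 \<le> T \<and> ennreal T = (\<integral>\<^sup>+x. ennreal (G p x) * indicator (dyadic_band m) x \<partial>?\<mu>) \<and>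
      (\<lambda>k. \<Sum>i\<in>?I k. G p (?a k i) * measure ?\<mu> (?c k i)) \<longlonglongrightarrow> T" if p: "p \<in> P" for p
  proof -
    have "continuous_on {0<..} (G p)" unfolding G_def using cont[OF p] by (intro continuous_intros)
    moreover have "G p \<in> borel_measurable borel" unfolding G_def[abs_def] using meas[OF p] by measurable
    moreover have "0 \<le> G p x \<and> G p x \<le> C" if x: "x \<in> dyadic_band m" for x
    proof -
      have "0 \<le> g p x" using nonneg[OF p] dyadic_band_pos[OF x] by simp
      moreover have "exp (- lam * x) \<le> 1" using lam dyadic_band_pos[OF x] by simp
      ultimately have "g p x * exp (- lam * x) \<le> C * 1" using C(1) C(2)[OF p x] by (intro mult_mono) auto
      then show ?thesis using \<open>0 \<le> g p x\<close> by (simp add: G_def)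
    qed
    ultimately obtain T where "0 \<le> T" "ennreal T = (\<integral>\<^sup>+x. ennreal (G p x) * indicator (dyadic_band m) x \<partial>?\<mu>)"
      "(\<lambda>k. \<Sum>i\<in>?I k. G p (?a k i) * measure ?\<mu> (?c k i)) \<longlonglongrightarrow> T"
      using riemann_sum_PD_intensity[OF zeta(1) _ _ C(1)] by blast
    then show ?thesis by blast
  qed
  then have "\<forall>p\<in>P. \<exists>T. 0 \<le> T \<and> ennreal T = (\<integral>\<^sup>+x. ennreal (G p x) * indicator (dyadic_band m) x \<partial>?\<mu>) \<and>
      (\<lambda>k. \<Sum>i\<in>?I k. G p (?a k i) * measure ?\<mu> (?c k i)) \<longlonglongrightarrow> T" by (rule ballI)
  from bchoice[OF this] obtain T where "\<forall>p\<in>P. 0 \<le> T p \<and>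
      ennreal (T p) = (\<integral>\<^sup>+x. ennreal (G p x) * indicator (dyadic_band m) x \<partial>?\<mu>) \<and>
      (\<lambda>k. \<Sum>i\<in>?I k. G p (?a k i) * measure ?\<mu> (?c k i)) \<longlonglongrightarrow> T p" ..
  then have T: "\<And>p. p \<in> P \<Longrightarrow> 0 \<le> T p"
    "\<And>p. p \<in> P \<Longrightarrow> ennreal (T p) = (\<integral>\<^sup>+x. ennreal (G p x) * indicator (dyadic_band m) x \<partial>?\<mu>)"
    "\<And>p. p \<in> P \<Longrightarrow> (\<lambda>k. \<Sum>i\<in>?I k. G p (?a k i) * measure ?\<mu> (?c k i)) \<longlonglongrightarrow> T p"
    by (simp_all only: Ball_def)
  have S_lim: "S \<longlonglongrightarrow> (\<Prod>p\<in>P. T p)"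
    unfolding S_def[abs_def]
  proof (rule tendsto_sum_inj_tuples[OF P, where c = "\<lambda>k p i. g p (?a k i) * (exp (- lam * ?a k i) * measure ?\<mu> (?c k i))"
        and e = "\<lambda>k. C * ((1 / 2) ^ (m + k) * (1 / 2 ^ m) powr (- 1 - \<zeta>))"])
    fix k p i assume pi: "p \<in> P" "i \<in> ?I k"
    show "0 \<le> g p (?a k i) * (exp (- lam * ?a k i) * measure ?\<mu> (?c k i))"
      using g_bd[OF pi] by simp
    have "exp (- lam * ?a k i) * measure ?\<mu> (?c k i) \<le> 1 * ((1 / 2) ^ (m + k) * (1 / 2 ^ m) powr (- 1 - \<zeta>))"
      using lam measure_dyadic_cell_le[OF pi(2) zeta(1)] by (intro mult_mono) auto
    then show "g p (?a k i) * (exp (- lam * ?a k i) * measure ?\<mu> (?c k i)) \<le> C * ((1 / 2) ^ (m + k) * (1 / 2 ^ m) powr (- 1 - \<zeta>))"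
      using g_bd[OF pi] C(1) by (intro mult_mono[of "g p (?a k i)" C]) auto
  next
    have "(\<lambda>k. (1 / 2 :: real) ^ (k + m)) \<longlonglongrightarrow> 0"
      by (rule LIMSEQ_ignore_initial_segment) (simp add: LIMSEQ_power_zero)
    then have "(\<lambda>k. C * ((1 / 2) ^ (k + m) * (1 / 2 ^ m) powr (- 1 - \<zeta>))) \<longlonglongrightarrow> C * (0 * (1 / 2 ^ m) powr (- 1 - \<zeta>))"
      by (intro tendsto_intros)
    then show "(\<lambda>k. C * ((1 / 2) ^ (m + k) * (1 / 2 ^ m) powr (- 1 - \<zeta>))) \<longlonglongrightarrow> 0"
      by (simp add: add.commute)
  next
    fix p assume "p \<in> P"
    from T(3)[OF this] show "(\<lambda>k. \<Sum>i\<in>?I k. g p (?a k i) * (exp (- lam * ?a k i) * measure ?\<mu> (?c k i))) \<longlonglongrightarrow> T p"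
      by (simp add: G_def mult.assoc)
  qed simp
  have "(\<lambda>k. ennreal (S k) * (\<integral>\<^sup>+\<omega>. ennreal (V k \<omega>) \<partial>M)) \<longlonglongrightarrow> ennreal (\<Prod>p\<in>P. T p) * (\<integral>\<^sup>+\<omega>. ennreal (exp (- lam * U \<omega>)) \<partial>M)"
    using V_fin by (intro tendsto_mult_ennreal tendsto_ennrealI S_lim V_lim) auto
  then have "(\<integral>\<^sup>+\<omega>. H \<omega> \<partial>M) = ennreal (\<Prod>p\<in>P. T p) * (\<integral>\<^sup>+\<omega>. ennreal (exp (- lam * U \<omega>)) \<partial>M)"
    using lhs unfolding mecke by (intro LIMSEQ_unique)
  also have "ennreal (\<Prod>p\<in>P. T p) = (\<Prod>p\<in>P. ennreal (T p))"
    using T(1) by (simp add: prod_ennreal)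
  also have "\<dots> = (\<Prod>p\<in>P. \<integral>\<^sup>+x. ennreal (G p x) * indicator (dyadic_band m) x \<partial>?\<mu>)"
    using T(2) by (intro prod.cong) auto
  finally show ?thesis unfolding H_def U_def G_def .
qed

text \<open>
  The full identity follows by monotone convergence along the bands.
\<close>

lemma mecke_exp:
  fixes g :: "'p \<Rightarrow> real \<Rightarrow> real"
  assumes P: "finite P" and cont: "\<And>p. p \<in> P \<Longrightarrow> continuous_on {0<..} (g p)"
    and meas: "\<And>p. p \<in> P \<Longrightarrow> g p \<in> borel_measurable borel"
    and nonneg: "\<And>p x. p \<in> P \<Longrightarrow> 0 < x \<Longrightarrow> 0 \<le> g p x" and lam: "0 < lam"
    and fin: "\<And>p. p \<in> P \<Longrightarrow> (\<integral>\<^sup>+x. ennreal (g p x * exp (- lam * x)) \<partial>PD_intensity \<zeta>) < \<infinity>"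
  shows "(\<integral>\<^sup>+\<omega>. \<integral>\<^sup>+l. ennreal ((\<Prod>p\<in>P. g p (u (l p) \<omega>)) * exp (- lam * (\<Sum>j. u j \<omega>)))
            \<partial>count_space (inj_tuples P UNIV) \<partial>M)
       = (\<Prod>p\<in>P. \<integral>\<^sup>+x. ennreal (g p x * exp (- lam * x)) \<partial>PD_intensity \<zeta>)
         * (\<integral>\<^sup>+\<omega>. ennreal (exp (- lam * (\<Sum>j. u j \<omega>))) \<partial>M)"
proof -
  let ?\<mu> = "PD_intensity \<zeta>" and ?E = "\<integral>\<^sup>+\<omega>. ennreal (exp (- lam * (\<Sum>j. u j \<omega>))) \<partial>M"
  \<comment> \<open>Points are positive only almost surely; with the set \<open>{0<..}\<close> the limit holds for every \<open>\<omega>\<close>.\<close>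
  define h where "h A l \<omega> = ennreal ((\<Prod>p\<in>P. g p (u (l p) \<omega>) * indicator A (u (l p) \<omega>)) * exp (- lam * (\<Sum>j. u j \<omega>)))"
    for A :: "real set" and l :: "'p \<Rightarrow> nat" and \<omega>
  have h_mono: "h A l \<omega> \<le> h B l \<omega>" if "A \<subseteq> B" "B \<subseteq> {0<..}" for A B l \<omega>
    unfolding h_def using that nonneg
    by (intro ennreal_leI mult_right_mono prod_mono) (auto simp: indicator_def split: if_splits)
  have band_sub: "dyadic_band m \<subseteq> {0<..}" for m using dyadic_band_pos by auto
  have ind_ev: "\<forall>\<^sub>F m in sequentially. (indicator (dyadic_band m) x :: real) = indicator {0<..} x" for x
  proof (cases "0 < x")
    case True
    obtain N where N: "\<forall>m\<ge>N. x \<in> dyadic_band m" using dyadic_band_exhausts[OF True] by blast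
    show ?thesis
      unfolding eventually_sequentially using True N by (intro exI[of _ N]) simp
  next
    case False
    then have "x \<notin> dyadic_band m" for m using dyadic_band_pos by auto
    then show ?thesis using False by simp
  qed
  have h_lim: "(\<lambda>m. h (dyadic_band m) l \<omega>) \<longlonglongrightarrow> h {0<..} l \<omega>" for l \<omega>
  proof -
    have "\<forall>\<^sub>F m in sequentially. \<forall>p\<in>P. (indicator (dyadic_band m) (u (l p) \<omega>) :: real) = indicator {0<..} (u (l p) \<omega>)"
      by (intro eventually_ball_finite P ballI ind_ev)
    then have "\<forall>\<^sub>F m in sequentially. h {0<..} l \<omega> = h (dyadic_band m) l \<omega>"
      by (rule eventually_mono) (auto simp: h_def intro!: arg_cong[where f = ennreal] prod.cong)
    then show ?thesis by (rule Lim_transform_eventually[OF tendsto_const])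
  qed
  have h_meas: "h A l \<in> borel_measurable M" if A: "A \<in> sets borel" for A l
  proof -
    have [measurable]: "(\<lambda>\<omega>. g p (u (l p) \<omega>) * indicator A (u (l p) \<omega>)) \<in> borel_measurable M" if "p \<in> P" for p
      using meas[OF that] A by (intro measurable_compose[OF measurable_u] borel_measurable_times) auto
    show ?thesis unfolding h_def[abs_def] by measurable
  qed
  have lhs: "(\<lambda>m. \<integral>\<^sup>+\<omega>. \<integral>\<^sup>+l. h (dyadic_band m) l \<omega> \<partial>count_space (inj_tuples P UNIV) \<partial>M)
     \<longlonglongrightarrow> (\<integral>\<^sup>+\<omega>. \<integral>\<^sup>+l. h {0<..} l \<omega> \<partial>count_space (inj_tuples P UNIV) \<partial>M)"
  proof (rule nn_integral_LIMSEQ)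
    show "incseq (\<lambda>m \<omega>. \<integral>\<^sup>+l. h (dyadic_band m) l \<omega> \<partial>count_space (inj_tuples P UNIV))"
      by (auto simp: incseq_def le_fun_def intro!: nn_integral_mono h_mono incseq_dyadic_band band_sub)
    show "(\<lambda>\<omega>. \<integral>\<^sup>+l. h (dyadic_band m) l \<omega> \<partial>count_space (inj_tuples P UNIV)) \<in> borel_measurable M" for m
      using P by (intro borel_measurable_nn_integral_count_space countable_inj_tuples h_meas) auto
    show "(\<lambda>m. \<integral>\<^sup>+l. h (dyadic_band m) l \<omega> \<partial>count_space (inj_tuples P UNIV))
       \<longlonglongrightarrow> (\<integral>\<^sup>+l. h {0<..} l \<omega> \<partial>count_space (inj_tuples P UNIV))" for \<omega>
      by (intro nn_integral_LIMSEQ h_lim)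
         (auto simp: incseq_def le_fun_def intro!: h_mono incseq_dyadic_band band_sub)
  qed
  have T: "(\<lambda>m. \<integral>\<^sup>+x. ennreal (g p x * exp (- lam * x)) * indicator (dyadic_band m) x \<partial>?\<mu>)
     \<longlonglongrightarrow> (\<integral>\<^sup>+x. ennreal (g p x * exp (- lam * x)) \<partial>?\<mu>)" if p: "p \<in> P" for p
  proof -
    have [measurable]: "g p \<in> borel_measurable borel" by (rule meas[OF p])
    have "(\<lambda>m. \<integral>\<^sup>+x. ennreal (g p x * exp (- lam * x)) * indicator (dyadic_band m) x \<partial>?\<mu>)
     \<longlonglongrightarrow> (\<integral>\<^sup>+x. ennreal (g p x * exp (- lam * x)) * indicator {0<..} x \<partial>?\<mu>)"
    proof (rule nn_integral_LIMSEQ)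
      show "incseq (\<lambda>m x. ennreal (g p x * exp (- lam * x)) * indicator (dyadic_band m) x)"
        using incseq_dyadic_band by (auto simp: incseq_def le_fun_def indicator_def)
      show "(\<lambda>x. ennreal (g p x * exp (- lam * x)) * indicator (dyadic_band m) x) \<in> borel_measurable ?\<mu>" for m
        by (intro measurable_PD_intensity) measurable
      show "(\<lambda>m. ennreal (g p x * exp (- lam * x)) * indicator (dyadic_band m) x)
         \<longlonglongrightarrow> ennreal (g p x * exp (- lam * x)) * indicator {0<..} x" for x
      proof -
        have "\<forall>\<^sub>F m in sequentially. ennreal (g p x * exp (- lam * x)) * indicator {0<..} x
           = ennreal (g p x * exp (- lam * x)) * indicator (dyadic_band m) x"
          using ind_ev[of x] by (rule eventually_mono) (auto simp: indicator_def split: if_splits)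
        then show ?thesis by (rule Lim_transform_eventually[OF tendsto_const])
      qed
    qed
    also have "(\<integral>\<^sup>+x. ennreal (g p x * exp (- lam * x)) * indicator {0<..} x \<partial>?\<mu>) = (\<integral>\<^sup>+x. ennreal (g p x * exp (- lam * x)) \<partial>?\<mu>)"
      by (intro nn_integral_cong) (simp add: space_PD_intensity)
    finally show ?thesis .
  qed
  have E_fin: "?E < \<infinity>"
  proof -
    have "?E \<le> (\<integral>\<^sup>+\<omega>. 1 \<partial>M)"
    proof (rule nn_integral_mono_AE, use AE_summable_points in eventually_elim)
      case (elim \<omega>)
      then have "0 \<le> (\<Sum>j. u j \<omega>)"
        by (intro suminf_nonneg) (auto simp: summable_points_def less_imp_le)
      then show "ennreal (exp (- lam * (\<Sum>j. u j \<omega>))) \<le> 1" using lam by (simp add: ennreal_le_1)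
    qed
    then show ?thesis by (rule le_less_trans) (simp add: emeasure_space_1)
  qed
  have rhs: "(\<lambda>m. (\<Prod>p\<in>P. \<integral>\<^sup>+x. ennreal (g p x * exp (- lam * x)) * indicator (dyadic_band m) x \<partial>?\<mu>) * ?E)
     \<longlonglongrightarrow> (\<Prod>p\<in>P. \<integral>\<^sup>+x. ennreal (g p x * exp (- lam * x)) \<partial>?\<mu>) * ?E"
    using E_fin tendsto_prod_ennreal[OF P, where f = "\<lambda>p m. \<integral>\<^sup>+x. ennreal (g p x * exp (- lam * x)) * indicator (dyadic_band m) x \<partial>?\<mu>", OF T fin]
    by (intro tendsto_mult_ennreal tendsto_const) (auto simp: less_top)
  have "(\<integral>\<^sup>+\<omega>. \<integral>\<^sup>+l. h {0<..} l \<omega> \<partial>count_space (inj_tuples P UNIV) \<partial>M)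
      = (\<Prod>p\<in>P. \<integral>\<^sup>+x. ennreal (g p x * exp (- lam * x)) \<partial>?\<mu>) * ?E"
  proof (rule LIMSEQ_unique[OF lhs])
    have "(\<integral>\<^sup>+\<omega>. \<integral>\<^sup>+l. h (dyadic_band m) l \<omega> \<partial>count_space (inj_tuples P UNIV) \<partial>M)
        = (\<Prod>p\<in>P. \<integral>\<^sup>+x. ennreal (g p x * exp (- lam * x)) * indicator (dyadic_band m) x \<partial>?\<mu>) * ?E" for m
      unfolding h_def by (rule mecke_band[OF P]) (use cont meas nonneg lam in auto)
    then show "(\<lambda>m. \<integral>\<^sup>+\<omega>. \<integral>\<^sup>+l. h (dyadic_band m) l \<omega> \<partial>count_space (inj_tuples P UNIV) \<partial>M)
       \<longlonglongrightarrow> (\<Prod>p\<in>P. \<integral>\<^sup>+x. ennreal (g p x * exp (- lam * x)) \<partial>?\<mu>) * ?E"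
      using rhs by simp
  qed
  moreover have "(\<integral>\<^sup>+\<omega>. \<integral>\<^sup>+l. h {0<..} l \<omega> \<partial>count_space (inj_tuples P UNIV) \<partial>M)
     = (\<integral>\<^sup>+\<omega>. \<integral>\<^sup>+l. ennreal ((\<Prod>p\<in>P. g p (u (l p) \<omega>)) * exp (- lam * (\<Sum>j. u j \<omega>)))
            \<partial>count_space (inj_tuples P UNIV) \<partial>M)"
  proof (rule nn_integral_cong_AE, use AE_summable_points in eventually_elim)
    case (elim \<omega>)
    then show ?case by (intro nn_integral_cong) (simp add: h_def summable_points_def)
  qed
  ultimately show ?thesis by simp
qed

end

section \<open>Scaling and the invariance\<close>

lemma nn_integral_power_exp_Ioi:
  assumes D: "0 < D"
  shows "(\<integral>\<^sup>+x. ennreal (x ^ k * exp (- (x * D))) * indicator {0<..} x \<partial>lborel) = ennreal (fact k / D ^ Suc k)"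
proof -
  have "(\<integral>\<^sup>+x. ennreal (x ^ k * exp (- x)) * indicator {0..} x \<partial>lborel)
      = ennreal D * (\<integral>\<^sup>+x. ennreal ((D * x) ^ k * exp (- (D * x))) * indicator {0..} (D * x) \<partial>lborel)"
    using D nn_integral_real_affine[of "\<lambda>x. ennreal (x ^ k * exp (- x)) * indicator {0..} x" D 0] by simp
  also have "(\<integral>\<^sup>+x. ennreal ((D * x) ^ k * exp (- (D * x))) * indicator {0..} (D * x) \<partial>lborel)
      = (\<integral>\<^sup>+x. ennreal (D ^ k) * (ennreal (x ^ k * exp (- (x * D))) * indicator {0<..} x) \<partial>lborel)"
    using AE_lborel_singleton[of "0::real"]
  proof (intro nn_integral_cong_AE, eventually_elim)
    case (elim x)
    then show ?case
      using D by (auto simp: indicator_def power_mult_distrib zero_le_mult_iff mult.assoc mult.commute[of D] ennreal_mult'[symmetric])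
  qed
  also have "\<dots> = ennreal (D ^ k) * (\<integral>\<^sup>+x. ennreal (x ^ k * exp (- (x * D))) * indicator {0<..} x \<partial>lborel)"
    by (rule nn_integral_cmult) measurable
  finally have eq: "ennreal (fact k) = ennreal (D ^ Suc k) * (\<integral>\<^sup>+x. ennreal (x ^ k * exp (- (x * D))) * indicator {0<..} x \<partial>lborel)"
    using D by (simp add: nn_intergal_power_times_exp_Ici ennreal_mult' mult.assoc)
  have inv: "ennreal (1 / D ^ Suc k * D ^ Suc k) = ennreal (1 / D ^ Suc k) * ennreal (D ^ Suc k)"
    by (rule ennreal_mult') (use D in simp)
  have "ennreal (1 / D ^ Suc k) * ennreal (fact k)
      = ennreal (1 / D ^ Suc k * D ^ Suc k) * (\<integral>\<^sup>+x. ennreal (x ^ k * exp (- (x * D))) * indicator {0<..} x \<partial>lborel)"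
    unfolding eq inv by (simp only: mult.assoc)
  then show ?thesis using D by (simp flip: ennreal_mult')
qed

text \<open>
  The Laplace transform at \<open>c\<close> of the intensity measure weighted by \<open>x ^ k\<close>. For \<open>k\<close> greater than \<open>\<zeta>\<close>
  and positive \<open>c\<close> its value is \<open>Gamma (k - \<zeta>) * c powr (\<zeta> - k)\<close>.
\<close>

definition PD_laplace_moment :: "real \<Rightarrow> nat \<Rightarrow> real \<Rightarrow> ennreal" where
  "PD_laplace_moment \<zeta> k c = (\<integral>\<^sup>+x. ennreal (x ^ k * exp (- c * x)) \<partial>PD_intensity \<zeta>)"

lemma PD_laplace_moment_scale:
  "ennreal (exp ((real k - \<zeta>) * s)) * PD_laplace_moment \<zeta> k (c * exp s) = PD_laplace_moment \<zeta> k c"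
proof -
  let ?f = "\<lambda>c x. ennreal (x powr (- 1 - \<zeta>)) * ennreal (x ^ k * exp (- c * x)) * indicator {0<..} x"
  have T: "PD_laplace_moment \<zeta> k c = (\<integral>\<^sup>+x. ?f c x \<partial>lborel)" for c
    unfolding PD_laplace_moment_def by (subst nn_integral_PD_intensity) auto
  have "PD_laplace_moment \<zeta> k c = ennreal (exp s) * (\<integral>\<^sup>+x. ?f c (exp s * x) \<partial>lborel)"
    unfolding T using nn_integral_real_affine[of "?f c" "exp s" 0] by simp
  also have "\<dots> = (\<integral>\<^sup>+x. ennreal (exp s) * ?f c (exp s * x) \<partial>lborel)"
    by (rule nn_integral_cmult[symmetric]) measurable
  also have "\<dots> = (\<integral>\<^sup>+x. ennreal (exp ((real k - \<zeta>) * s)) * ?f (c * exp s) x \<partial>lborel)"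
  proof (rule nn_integral_cong)
    fix x :: real
    show "ennreal (exp s) * ?f c (exp s * x) = ennreal (exp ((real k - \<zeta>) * s)) * ?f (c * exp s) x"
    proof (cases "0 < x")
      case True
      have e: "exp s * (exp s powr (- 1 - \<zeta>) * exp s ^ k) = exp ((real k - \<zeta>) * s)"
        by (simp add: powr_def exp_of_nat_mult[symmetric] exp_add[symmetric] algebra_simps)
      have "exp s * ((exp s * x) powr (- 1 - \<zeta>) * ((exp s * x) ^ k * exp (- c * (exp s * x))))
         = (exp s * (exp s powr (- 1 - \<zeta>) * exp s ^ k)) * (x powr (- 1 - \<zeta>) * (x ^ k * exp (- (c * exp s) * x)))"
        using True by (simp add: powr_mult power_mult_distrib ac_simps)
      then show ?thesis
        unfolding e using True by (simp add: ennreal_mult'[symmetric] zero_less_mult_iff mult.assoc)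
    qed (simp add: zero_less_mult_iff)
  qed
  also have "\<dots> = ennreal (exp ((real k - \<zeta>) * s)) * PD_laplace_moment \<zeta> k (c * exp s)"
    unfolding T by (rule nn_integral_cmult) measurable
  finally show ?thesis by simp
qed

lemma PD_laplace_moment_finite:
  assumes z: "\<zeta> < 1" and k: "1 \<le> k" and c: "0 < c"
  shows "PD_laplace_moment \<zeta> k c < \<infinity>"
proof -
  define h where "h t = (if t \<in> {0..} then t powr (real k - \<zeta> - 1) / exp t else 0)" for t :: real
  have pos: "0 < real k - \<zeta>" using z k by linarith
  have "(h has_integral Gamma (real k - \<zeta>)) UNIV"
    unfolding h_def using Gamma_integral_real[OF pos] by (subst has_integral_restrict_UNIV)
  then have "(\<integral>\<^sup>+t. ennreal (h t) \<partial>lborel) = ennreal (Gamma (real k - \<zeta>))"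
    by (intro nn_integral_has_integral_lborel) (auto simp: h_def[abs_def])
  moreover have "PD_laplace_moment \<zeta> k 1 \<le> (\<integral>\<^sup>+t. ennreal (h t) \<partial>lborel)"
    unfolding PD_laplace_moment_def
  proof (subst nn_integral_PD_intensity)
    show "(\<integral>\<^sup>+x. ennreal (x powr (- 1 - \<zeta>)) * ennreal (x ^ k * exp (- 1 * x)) * indicator {0<..} x \<partial>lborel) \<le> (\<integral>\<^sup>+t. ennreal (h t) \<partial>lborel)"
    proof (rule nn_integral_mono)
      fix x :: real
      show "ennreal (x powr (- 1 - \<zeta>)) * ennreal (x ^ k * exp (- 1 * x)) * indicator {0<..} x \<le> ennreal (h x)"
      proof (cases "0 < x")
        case True
        have "x powr (- 1 - \<zeta>) * x ^ k = x powr (real k - \<zeta> - 1)"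
          using True by (simp add: powr_realpow[symmetric] powr_add[symmetric] algebra_simps)
        then have "x powr (- 1 - \<zeta>) * (x ^ k * exp (- 1 * x)) = h x"
          using True by (simp add: h_def exp_minus divide_inverse flip: mult.assoc)
        then show ?thesis using True by (simp flip: ennreal_mult')
      qed simp
    qed
  qed measurable
  ultimately have "PD_laplace_moment \<zeta> k 1 < \<infinity>" by (simp add: le_less_trans)
  then show ?thesis
    \<comment> \<open>Scaling with \<open>s = - ln c\<close> reduces the claim to \<open>c = 1\<close>, where the integral is a Gamma value.\<close>
    using PD_laplace_moment_scale[of k \<zeta> "- ln c" c] c
    by (simp add: ennreal_mult_less_top exp_minus flip: PD_laplace_moment_scale[of k \<zeta> "- ln c" c])
qed

context pd_process
begin

text \<open>
  Here \<open>1 / D ^ n\<close> is written as the integral of \<open>lam ^ (n - 1) * exp (- lam * D) / fact (n - 1)\<close>, where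
  \<open>D\<close> is the denominator. In \<open>D\<close> the chosen points appear with weight \<open>exp (s p)\<close> and the others with
  weight \<open>1\<close>, so that \<open>mecke_exp\<close> applies for each \<open>lam\<close>. After rescaling the integration variables the
  right-hand side is free of \<open>s\<close>.
\<close>

lemma tilted_moment:
  fixes P :: "'p set" and k :: "'p \<Rightarrow> nat" and s :: "'p \<Rightarrow> real"
  assumes P: "finite P" "P \<noteq> {}" and k: "\<And>p. p \<in> P \<Longrightarrow> 1 \<le> k p" and n: "1 \<le> n"
  shows "(\<integral>\<^sup>+\<omega>. \<integral>\<^sup>+l. ennreal (exp (\<Sum>p\<in>P. (real (k p) - \<zeta>) * s p)
              / ((\<Sum>p\<in>P. u (l p) \<omega> * exp (s p)) + (\<Sum>j. u j \<omega>) - (\<Sum>p\<in>P. u (l p) \<omega>)) ^ n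
              * (\<Prod>p\<in>P. u (l p) \<omega> ^ k p)) \<partial>count_space (inj_tuples P UNIV) \<partial>M)
       = (\<integral>\<^sup>+lam. ennreal (lam ^ (n - 1) / fact (n - 1)) * indicator {0<..} lam
            * ((\<Prod>p\<in>P. PD_laplace_moment \<zeta> (k p) lam) * (\<integral>\<^sup>+\<omega>. ennreal (exp (- lam * (\<Sum>j. u j \<omega>))) \<partial>M)) \<partial>lborel)"
proof -
  define U where "U \<omega> = (\<Sum>j. u j \<omega>)" for \<omega>
  have [measurable]: "U \<in> borel_measurable M" unfolding U_def by measurable
  define D where "D l \<omega> = (\<Sum>p\<in>P. u (l p) \<omega> * exp (s p)) + U \<omega> - (\<Sum>p\<in>P. u (l p) \<omega>)" for l \<omega>
  define E where "E = exp (\<Sum>p\<in>P. (real (k p) - \<zeta>) * s p)"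
  \<comment> \<open>The term \<open>lam * x\<close> removes the chosen points from \<open>exp (- lam * U \<omega>)\<close>, where they are to be reweighted.\<close>
  define g where "g lam p x = exp ((real (k p) - \<zeta>) * s p) * x ^ k p * exp (lam * x - lam * exp (s p) * x)" for lam p x
  define w where "w lam = ennreal (lam ^ (n - 1) / fact (n - 1)) * indicator {0<..} lam" for lam :: real
  define h where "h lam l \<omega> = ennreal ((\<Prod>p\<in>P. g lam p (u (l p) \<omega>)) * exp (- lam * U \<omega>))" for lam l \<omega>
  have cI: "countable (inj_tuples P (UNIV :: nat set))" using P by (intro countable_inj_tuples) auto
  have [measurable]: "w \<in> borel_measurable borel" unfolding w_def by measurable
  have h_joint [measurable]: "(\<lambda>(\<omega>, lam). w lam * h lam l \<omega>) \<in> borel_measurable (M \<Otimes>\<^sub>M lborel)" for l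
    unfolding h_def g_def by measurable
  have h_M [measurable]: "h lam l \<in> borel_measurable M" for lam l
    unfolding h_def g_def by measurable
  interpret L: pair_sigma_finite M lborel ..

  have prod_g: "(\<Prod>p\<in>P. g lam p (u (l p) \<omega>)) * exp (- lam * U \<omega>)
      = E * (\<Prod>p\<in>P. u (l p) \<omega> ^ k p) * exp (- (lam * D l \<omega>))" for lam l \<omega>
  proof -
    have "(\<Prod>p\<in>P. g lam p (u (l p) \<omega>)) = E * (\<Prod>p\<in>P. u (l p) \<omega> ^ k p)
        * exp (\<Sum>p\<in>P. lam * u (l p) \<omega> - lam * exp (s p) * u (l p) \<omega>)"
      unfolding g_def prod.distrib E_def using P by (simp add: exp_sum)
    moreover have "(\<Sum>p\<in>P. lam * u (l p) \<omega> - lam * exp (s p) * u (l p) \<omega>) + - lam * U \<omega> = - (lam * D l \<omega>)"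
      unfolding D_def by (simp add: sum_subtractf sum_distrib_left algebra_simps)
    ultimately show ?thesis by (simp add: mult.assoc flip: exp_add)
  qed

  have "(\<integral>\<^sup>+\<omega>. \<integral>\<^sup>+l. ennreal (E / D l \<omega> ^ n * (\<Prod>p\<in>P. u (l p) \<omega> ^ k p)) \<partial>count_space (inj_tuples P UNIV) \<partial>M)
      = (\<integral>\<^sup>+\<omega>. \<integral>\<^sup>+l. \<integral>\<^sup>+lam. w lam * h lam l \<omega> \<partial>lborel \<partial>count_space (inj_tuples P UNIV) \<partial>M)"
  proof (rule nn_integral_cong_AE, use AE_summable_points in eventually_elim)
    case (elim \<omega>)
    interpret summable_points "\<lambda>l. u l \<omega>" using elim by simp
    show ?case
    proof (rule nn_integral_cong)
      fix l assume "l \<in> space (count_space (inj_tuples P (UNIV :: nat set)))"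
      then have l: "inj_on l P" by (simp add: inj_tuples_def)
      have "(\<Sum>p\<in>P. u (l p) \<omega>) = (\<Sum>j\<in>l ` P. u j \<omega>)" using l by (simp add: sum.reindex)
      also have "\<dots> \<le> U \<omega>" unfolding U_def using pos P summable by (intro sum_le_suminf) (auto simp: less_imp_le)
      finally have "(\<Sum>p\<in>P. u (l p) \<omega>) \<le> U \<omega>" .
      moreover have "0 < (\<Sum>p\<in>P. u (l p) \<omega> * exp (s p))" using P pos by (intro sum_pos) auto
      ultimately have D: "0 < D l \<omega>" by (simp add: D_def)
      let ?c = "E * (\<Prod>p\<in>P. u (l p) \<omega> ^ k p)"
      have c: "0 \<le> ?c" using pos by (auto simp: E_def less_imp_le intro!: mult_nonneg_nonneg prod_nonneg)
      have "(\<integral>\<^sup>+lam. w lam * h lam l \<omega> \<partial>lborel)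
         = (\<integral>\<^sup>+lam. ennreal (?c / fact (n - 1)) * (ennreal (lam ^ (n - 1) * exp (- (lam * D l \<omega>))) * indicator {0<..} lam) \<partial>lborel)"
      proof (rule nn_integral_cong)
        fix lam :: real
        show "w lam * h lam l \<omega> = ennreal (?c / fact (n - 1)) * (ennreal (lam ^ (n - 1) * exp (- (lam * D l \<omega>))) * indicator {0<..} lam)"
          unfolding w_def h_def prod_g using c
          by (cases "0 < lam") (simp_all add: ennreal_mult'[symmetric] mult_ac)
      qed
      also have "\<dots> = ennreal (?c / fact (n - 1)) * ennreal (fact (n - 1) / D l \<omega> ^ Suc (n - 1))"
        using D by (subst nn_integral_cmult) (auto simp: nn_integral_power_exp_Ioi)
      also have "\<dots> = ennreal (E / D l \<omega> ^ n * (\<Prod>p\<in>P. u (l p) \<omega> ^ k p))"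
        using c D n by (simp add: ennreal_mult'[symmetric])
      finally show "ennreal (E / D l \<omega> ^ n * (\<Prod>p\<in>P. u (l p) \<omega> ^ k p)) = (\<integral>\<^sup>+lam. w lam * h lam l \<omega> \<partial>lborel)" ..
    qed
  qed
  also have "\<dots> = (\<integral>\<^sup>+l. \<integral>\<^sup>+\<omega>. \<integral>\<^sup>+lam. w lam * h lam l \<omega> \<partial>lborel \<partial>M \<partial>count_space (inj_tuples P UNIV))"
    by (intro nn_integral_count_space_nn_integral cI lborel.borel_measurable_nn_integral h_joint)
  also have "\<dots> = (\<integral>\<^sup>+l. \<integral>\<^sup>+lam. \<integral>\<^sup>+\<omega>. w lam * h lam l \<omega> \<partial>M \<partial>lborel \<partial>count_space (inj_tuples P UNIV))"
    by (intro nn_integral_cong L.Fubini'[symmetric] h_joint)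
  also have "\<dots> = (\<integral>\<^sup>+lam. \<integral>\<^sup>+l. \<integral>\<^sup>+\<omega>. w lam * h lam l \<omega> \<partial>M \<partial>count_space (inj_tuples P UNIV) \<partial>lborel)"
  proof (rule nn_integral_count_space_nn_integral[symmetric, OF cI])
    fix l
    have "(\<lambda>(lam, \<omega>). w lam * h lam l \<omega>) \<in> borel_measurable (lborel \<Otimes>\<^sub>M M)"
      using measurable_pair_swap[OF h_joint[of l]] by (simp add: case_prod_unfold)
    then show "(\<lambda>lam. \<integral>\<^sup>+\<omega>. w lam * h lam l \<omega> \<partial>M) \<in> borel_measurable lborel"
      by (rule borel_measurable_nn_integral)
  qed
  also have "\<dots> = (\<integral>\<^sup>+lam. w lam * ((\<Prod>p\<in>P. PD_laplace_moment \<zeta> (k p) lam) * (\<integral>\<^sup>+\<omega>. ennreal (exp (- lam * U \<omega>)) \<partial>M)) \<partial>lborel)"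
  proof (rule nn_integral_cong)
    fix lam :: real
    show "(\<integral>\<^sup>+l. \<integral>\<^sup>+\<omega>. w lam * h lam l \<omega> \<partial>M \<partial>count_space (inj_tuples P UNIV))
      = w lam * ((\<Prod>p\<in>P. PD_laplace_moment \<zeta> (k p) lam) * (\<integral>\<^sup>+\<omega>. ennreal (exp (- lam * U \<omega>)) \<partial>M))"
    proof (cases "0 < lam")
      case True
      have T: "(\<integral>\<^sup>+x. ennreal (g lam p x * exp (- lam * x)) \<partial>PD_intensity \<zeta>) = PD_laplace_moment \<zeta> (k p) lam" if "p \<in> P" for p
      proof -
        have "g lam p x * exp (- lam * x) = exp ((real (k p) - \<zeta>) * s p) * (x ^ k p * exp (- (lam * exp (s p)) * x))" for x
          unfolding g_def by (simp add: mult.assoc flip: exp_add)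
        then have "(\<integral>\<^sup>+x. ennreal (g lam p x * exp (- lam * x)) \<partial>PD_intensity \<zeta>)
          = (\<integral>\<^sup>+x. ennreal (exp ((real (k p) - \<zeta>) * s p)) * ennreal (x ^ k p * exp (- (lam * exp (s p)) * x)) \<partial>PD_intensity \<zeta>)"
          by (simp add: ennreal_mult')
        also have "\<dots> = ennreal (exp ((real (k p) - \<zeta>) * s p)) * PD_laplace_moment \<zeta> (k p) (lam * exp (s p))"
          unfolding PD_laplace_moment_def by (intro nn_integral_cmult measurable_PD_intensity) measurable
        finally show ?thesis by (simp add: PD_laplace_moment_scale)
      qed
      have "(\<integral>\<^sup>+l. \<integral>\<^sup>+\<omega>. w lam * h lam l \<omega> \<partial>M \<partial>count_space (inj_tuples P UNIV))
        = w lam * (\<integral>\<^sup>+l. \<integral>\<^sup>+\<omega>. h lam l \<omega> \<partial>M \<partial>count_space (inj_tuples P UNIV))"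
        by (simp add: nn_integral_cmult)
      also have "(\<integral>\<^sup>+l. \<integral>\<^sup>+\<omega>. h lam l \<omega> \<partial>M \<partial>count_space (inj_tuples P UNIV))
        = (\<integral>\<^sup>+\<omega>. \<integral>\<^sup>+l. h lam l \<omega> \<partial>count_space (inj_tuples P UNIV) \<partial>M)"
        by (intro nn_integral_count_space_nn_integral[symmetric] cI h_M)
      also have "\<dots> = (\<Prod>p\<in>P. \<integral>\<^sup>+x. ennreal (g lam p x * exp (- lam * x)) \<partial>PD_intensity \<zeta>) * (\<integral>\<^sup>+\<omega>. ennreal (exp (- lam * U \<omega>)) \<partial>M)"
        unfolding h_def U_def
      proof (rule mecke_exp[OF P(1)])
        fix p assume p: "p \<in> P"
        show "continuous_on {0<..} (g lam p)" unfolding g_def by (intro continuous_intros)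
        show "g lam p \<in> borel_measurable borel" unfolding g_def by measurable
        show "0 \<le> g lam p x" if "0 < x" for x using that by (simp add: g_def)
        show "(\<integral>\<^sup>+x. ennreal (g lam p x * exp (- lam * x)) \<partial>PD_intensity \<zeta>) < \<infinity>"
          unfolding T[OF p] using zeta k[OF p] True by (intro PD_laplace_moment_finite)
      qed (rule True)
      finally show ?thesis using T by simp
    qed (simp add: w_def)
  qed
  finally show ?thesis unfolding E_def D_def U_def w_def .
qed

text \<open>
  In terms of the normalised points: if \<open>n\<close> is the total exponent, all powers of the total sum cancel.
\<close>

lemma tilted_moment_normalized:
  fixes P :: "'p set" and k :: "'p \<Rightarrow> nat" and s :: "'p \<Rightarrow> real"
  assumes P: "finite P" "P \<noteq> {}" and k: "\<And>p. p \<in> P \<Longrightarrow> 1 \<le> k p" and n: "n = (\<Sum>p\<in>P. k p)"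
  shows "(\<integral>\<^sup>+\<omega>. \<integral>\<^sup>+l. ennreal (\<Prod>p\<in>P. (u (l p) \<omega> / (\<Sum>j. u j \<omega>)) ^ k p) \<partial>count_space (inj_tuples P UNIV) \<partial>M)
       = (\<integral>\<^sup>+\<omega>. \<integral>\<^sup>+l. ennreal (exp (\<Sum>p\<in>P. (real (k p) - \<zeta>) * s p)
              / ((\<Sum>p\<in>P. u (l p) \<omega> / (\<Sum>j. u j \<omega>) * exp (s p)) + 1 - (\<Sum>p\<in>P. u (l p) \<omega> / (\<Sum>j. u j \<omega>))) ^ n
              * (\<Prod>p\<in>P. (u (l p) \<omega> / (\<Sum>j. u j \<omega>)) ^ k p)) \<partial>count_space (inj_tuples P UNIV) \<partial>M)"
    (is "?lhs = ?rhs")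
proof -
  have n1: "1 \<le> n"
  proof -
    obtain p where "p \<in> P" using P by auto
    then show ?thesis unfolding n using k[of p] member_le_sum[of p P k] P by auto
  qed
  let ?F = "\<lambda>s. \<integral>\<^sup>+\<omega>. \<integral>\<^sup>+l. ennreal (exp (\<Sum>p\<in>P. (real (k p) - \<zeta>) * s p)
              / ((\<Sum>p\<in>P. u (l p) \<omega> * exp (s p)) + (\<Sum>j. u j \<omega>) - (\<Sum>p\<in>P. u (l p) \<omega>)) ^ n
              * (\<Prod>p\<in>P. u (l p) \<omega> ^ k p)) \<partial>count_space (inj_tuples P UNIV) \<partial>M"
  \<comment> \<open>The left-hand side is the case \<open>s = 0\<close>, in which the denominator is the total sum.\<close>
  have U_pos: "AE \<omega> in M. 0 < (\<Sum>j. u j \<omega>)"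
    using AE_summable_points
  proof eventually_elim
    case (elim \<omega>)
    then show ?case by (intro suminf_pos) (auto simp: summable_points_def)
  qed
  have pr: "(\<Prod>p\<in>P. (x p / U) ^ k p) = (\<Prod>p\<in>P. x p ^ k p) / U ^ n" for x and U :: real
    unfolding n power_sum by (simp add: power_divide prod_dividef)
  have "?lhs = ?F (\<lambda>_. 0)"
  proof (rule nn_integral_cong_AE, use U_pos in eventually_elim)
    case (elim \<omega>)
    show ?case by (intro nn_integral_cong) (simp add: pr)
  qed
  also have "\<dots> = ?F s"
    by (rule trans[OF tilted_moment tilted_moment[symmetric]]) (use P k n1 in auto)
  also have "\<dots> = ?rhs"
  proof (rule nn_integral_cong_AE, use U_pos in eventually_elim)
    case (elim \<omega>)
    show ?case
    proof (intro nn_integral_cong arg_cong[where f = ennreal])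
      fix l :: "'p \<Rightarrow> nat"
      let ?U = "\<Sum>j. u j \<omega>" and ?A = "\<Sum>p\<in>P. u (l p) \<omega> * exp (s p)" and ?B = "\<Sum>p\<in>P. u (l p) \<omega>"
      have den: "(\<Sum>p\<in>P. u (l p) \<omega> / ?U * exp (s p)) + 1 - (\<Sum>p\<in>P. u (l p) \<omega> / ?U) = (?A + ?U - ?B) / ?U"
        using elim by (simp add: add_divide_distrib diff_divide_distrib sum_divide_distrib)
      show "exp (\<Sum>p\<in>P. (real (k p) - \<zeta>) * s p) / (?A + ?U - ?B) ^ n * (\<Prod>p\<in>P. u (l p) \<omega> ^ k p)
        = exp (\<Sum>p\<in>P. (real (k p) - \<zeta>) * s p) / ((\<Sum>p\<in>P. u (l p) \<omega> / ?U * exp (s p)) + 1 - (\<Sum>p\<in>P. u (l p) \<omega> / ?U)) ^ n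
          * (\<Prod>p\<in>P. (u (l p) \<omega> / ?U) ^ k p)"
        unfolding den pr using elim by (simp add: power_divide)
    qed
  qed
  finally show ?thesis .
qed

end

theorem mainTheorem9:
  fixes \<zeta> :: real
    and M :: "'w measure" and v :: "nat \<Rightarrow> 'w \<Rightarrow> real"
    and n r :: nat and I :: "nat \<Rightarrow> nat set" and m :: "nat \<Rightarrow> nat"
    and t s :: "nat \<Rightarrow> real"
  assumes "0 < \<zeta>" "\<zeta> < 1"
    and "has_poisson_dirichlet_distribution M v \<zeta>"
    and "n \<ge> 1" "r \<ge> 1"
    and "disjoint_family_on I {1..r}" "(\<Union>p\<in>{1..r}. I p) = {1..n}"
    and "\<And>p. p \<in> {1..r} \<Longrightarrow> I p \<noteq> {}"
    and "\<And>p. p \<in> {1..r} \<Longrightarrow> m p = card (I p)"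
    and "\<And>p. p \<in> {1..r} \<Longrightarrow> s p = (\<Sum>j\<in>I p. t j)"
  shows "(\<integral>\<^sup>+ \<omega>. (\<Sum>\<^sub>\<infinity> l \<in> distinct_tuples r.
            ennreal (\<Prod>p\<in>{1..r}. v (l p) \<omega> ^ m p)) \<partial>M)
       = (\<integral>\<^sup>+ \<omega>. (\<Sum>\<^sub>\<infinity> l \<in> distinct_tuples r.
            ennreal (exp (\<Sum>p\<in>{1..r}. (real (m p) - \<zeta>) * s p)
              / ((\<Sum>p\<in>{1..r}. v (l p) \<omega> * exp (s p)) + 1 - (\<Sum>p\<in>{1..r}. v (l p) \<omega>)) ^ n
              * (\<Prod>p\<in>{1..r}. v (l p) \<omega> ^ m p))) \<partial>M)"
proof -
  let ?P = "{1..r}" and ?N = "\<Pi>\<^sub>M l\<in>(UNIV :: nat set). (borel :: real measure)"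
  have v: "prob_space M" "\<And>l. v l \<in> borel_measurable M"
    and pd: "poisson_dirichlet \<zeta> (distr M ?N (\<lambda>\<omega> l. v l \<omega>))"
    using assms(3) by (auto simp: has_poisson_dirichlet_distribution_def)
  obtain M0 :: "(nat \<Rightarrow> real) measure" and \<Xi> u where
    M0: "poisson_point_process M0 (PD_intensity \<zeta>) \<Xi>" "decreasing_enumeration M0 \<Xi> u"
    and law: "distr M ?N (\<lambda>\<omega> l. v l \<omega>) = distr M0 ?N (\<lambda>\<omega> l. u l \<omega> / (\<Sum>j. u j \<omega>))"
    using pd unfolding poisson_dirichlet_def by blast
  interpret pd_process M0 \<zeta> \<Xi> u
    using M0 assms(1,2) by unfold_locales
  have tuples: "distinct_tuples r = inj_tuples ?P UNIV"
    by (auto simp: distinct_tuples_def inj_tuples_def)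
  have cI: "countable (inj_tuples ?P (UNIV :: nat set))" by (intro countable_inj_tuples) auto
  have I_fin: "finite (I p)" if "p \<in> ?P" for p
    using assms(7) that by (intro finite_subset[of "I p" "{1..n}"]) auto
  have m: "1 \<le> m p" if "p \<in> ?P" for p
    using assms(8,9)[OF that] I_fin[OF that] by (simp add: Suc_le_eq card_gt_0_iff)
  have n: "n = (\<Sum>p\<in>?P. m p)"
  proof -
    have "card (\<Union>p\<in>?P. I p) = (\<Sum>p\<in>?P. card (I p))"
      using I_fin assms(6) by (intro card_UN_disjoint) (auto simp: disjoint_family_on_def)
    then show ?thesis using assms(7,9) by simp
  qed
  have v_meas: "(\<lambda>\<omega> l. v l \<omega>) \<in> M \<rightarrow>\<^sub>M ?N"
    using v(2) by (intro measurable_PiM_single') auto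
  have u_meas: "(\<lambda>\<omega> l. u l \<omega> / (\<Sum>j. u j \<omega>)) \<in> M0 \<rightarrow>\<^sub>M ?N"
    by (intro measurable_PiM_single') auto
  \<comment> \<open>Both sides depend only on the law of \<open>v\<close>, which is that of the normalised points of the process.\<close>
  have transfer: "(\<integral>\<^sup>+\<omega>. (\<Sum>\<^sub>\<infinity>l\<in>distinct_tuples r. f l (\<lambda>j. v j \<omega>)) \<partial>M)
      = (\<integral>\<^sup>+\<omega>. \<integral>\<^sup>+l. f l (\<lambda>j. u j \<omega> / (\<Sum>j. u j \<omega>)) \<partial>count_space (inj_tuples ?P UNIV) \<partial>M0)"
    if f: "\<And>l. f l \<in> borel_measurable ?N" for f :: "(nat \<Rightarrow> nat) \<Rightarrow> (nat \<Rightarrow> real) \<Rightarrow> ennreal"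
  proof -
    let ?\<Phi> = "\<lambda>x. \<integral>\<^sup>+l. f l x \<partial>count_space (inj_tuples ?P UNIV)"
    have \<Phi>: "?\<Phi> \<in> borel_measurable ?N"
      by (intro borel_measurable_nn_integral_count_space cI f)
    have "(\<integral>\<^sup>+\<omega>. (\<Sum>\<^sub>\<infinity>l\<in>distinct_tuples r. f l (\<lambda>j. v j \<omega>)) \<partial>M) = (\<integral>\<^sup>+\<omega>. ?\<Phi> (\<lambda>j. v j \<omega>) \<partial>M)"
      unfolding tuples using cI by (simp add: infsum_ennreal_eq_nn_integral_count_space)
    also have "\<dots> = (\<integral>\<^sup>+x. ?\<Phi> x \<partial>distr M ?N (\<lambda>\<omega> l. v l \<omega>))"
      by (rule nn_integral_distr[OF v_meas, symmetric]) (use \<Phi> in simp)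
    also have "\<dots> = (\<integral>\<^sup>+\<omega>. ?\<Phi> (\<lambda>j. u j \<omega> / (\<Sum>j. u j \<omega>)) \<partial>M0)"
      unfolding law by (rule nn_integral_distr[OF u_meas]) (use \<Phi> in simp)
    finally show ?thesis .
  qed
  have comp [measurable]: "(\<lambda>x. x j) \<in> borel_measurable ?N" for j
    by (rule measurable_component_singleton) simp
  have "(\<integral>\<^sup>+\<omega>. (\<Sum>\<^sub>\<infinity>l\<in>distinct_tuples r. ennreal (\<Prod>p\<in>?P. v (l p) \<omega> ^ m p)) \<partial>M)
      = (\<integral>\<^sup>+\<omega>. \<integral>\<^sup>+l. ennreal (\<Prod>p\<in>?P. (u (l p) \<omega> / (\<Sum>j. u j \<omega>)) ^ m p)
           \<partial>count_space (inj_tuples ?P UNIV) \<partial>M0)"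
    by (rule transfer[of "\<lambda>l x. ennreal (\<Prod>p\<in>?P. x (l p) ^ m p)"]) measurable
  also have "\<dots> = (\<integral>\<^sup>+\<omega>. \<integral>\<^sup>+l. ennreal (exp (\<Sum>p\<in>?P. (real (m p) - \<zeta>) * s p)
          / ((\<Sum>p\<in>?P. u (l p) \<omega> / (\<Sum>j. u j \<omega>) * exp (s p)) + 1 - (\<Sum>p\<in>?P. u (l p) \<omega> / (\<Sum>j. u j \<omega>))) ^ n
          * (\<Prod>p\<in>?P. (u (l p) \<omega> / (\<Sum>j. u j \<omega>)) ^ m p)) \<partial>count_space (inj_tuples ?P UNIV) \<partial>M0)"
    by (rule tilted_moment_normalized) (use assms(5) m n in auto)
  also have "\<dots> = (\<integral>\<^sup>+\<omega>. (\<Sum>\<^sub>\<infinity>l\<in>distinct_tuples r. ennreal (exp (\<Sum>p\<in>?P. (real (m p) - \<zeta>) * s p)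
          / ((\<Sum>p\<in>?P. v (l p) \<omega> * exp (s p)) + 1 - (\<Sum>p\<in>?P. v (l p) \<omega>)) ^ n
          * (\<Prod>p\<in>?P. v (l p) \<omega> ^ m p))) \<partial>M)"
    by (rule transfer[of "\<lambda>l x. ennreal (exp (\<Sum>p\<in>?P. (real (m p) - \<zeta>) * s p)
          / ((\<Sum>p\<in>?P. x (l p) * exp (s p)) + 1 - (\<Sum>p\<in>?P. x (l p))) ^ n * (\<Prod>p\<in>?P. x (l p) ^ m p))", symmetric]) measurable
  finally show ?thesis .
qed

end
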